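(* Let $x\in\mathbb C\setminus((-\infty,-1]\cup[1,\infty))$ and $\alpha,\gamma\in\mathbb C$ with $\alpha+\gamma\notin-\mathbb N$. If $\gamma\notin-\mathbb N$, then $$\mathsf Q_\gamma^{(\alpha,\alpha)}(x)=\frac{2^\alpha\Gamma(\alpha+\gamma+1)}{\Gamma(\gamma+1)(1-x^2)^{\frac12\alpha}}\,\mathsf Q_{\gamma+\alpha}^{-\alpha}(x).$$ If $\gamma-\alpha\notin-\mathbb N$, then $$\mathsf Q_\gamma^{(\alpha,-\alpha)}(x)=\frac{\Gamma(\alpha+\gamma+1)}{\Gamma(\gamma+1)}\Bigl(\frac{1+x}{1-x}\Bigr)^{\frac12\alpha}\mathsf Q_\gamma^{-\alpha}(x),\qquad \mathsf Q_\gamma^{(-\alpha,\alpha)}(x)=\frac{\Gamma(\gamma-\alpha+1)}{\Gamma(\gamma+1)}\Bigl(\frac{1-x}{1+x}\Bigr)^{\frac12\alpha}\mathsf Q_\gamma^{\alpha}(x).$$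
   Context: $\mathbb N=\{1,2,3,\dots\}$. ${}_2\mathbf F_1(a,b;c;z)=\sum_{k\ge0}\frac{(a)_k(b)_k}{\Gamma(c+k)}\frac{z^k}{k!}$ is the Olver normalized Gauss hypergeometric function, continued analytically to $\mathbb C\setminus[1,\infty)$. Powers are principal, $(z^2-1)^a:=(z+1)^a(z-1)^a$; $1/\Gamma$ is $0$ at nonpositive integers. Jacobi function of the second kind ($\alpha+\gamma,\beta+\gamma\notin-\mathbb N$): $Q_\gamma^{(\alpha,\beta)}(z)=\frac{2^{\alpha+\beta+\gamma}\Gamma(\alpha+\gamma+1)\Gamma(\beta+\gamma+1)}{(z-1)^{\alpha+\gamma+1}(z+1)^\beta}{}_2\mathbf F_1\bigl(\gamma+1,\alpha+\gamma+1;\alpha+\beta+2\gamma+2;\tfrac2{1-z}\bigr)$, $z\in\mathbb C\setminus[-1,1]$. On the cut, for $x\in(-1,1)$: $\mathsf Q_\gamma^{(\alpha,\beta)}(x)=\tfrac12\bigl(e^{i\pi\alpha}Q_\gamma^{(\alpha,\beta)}(x+i0)+e^{-i\pi\alpha}Q_\gamma^{(\alpha,\beta)}(x-i0)\bigr)$. Associated Legendre function of the second kind ($\nu+\mu\notin-\mathbb N$): $Q_\nu^\mu(z)=\frac{\sqrt\pi\,e^{i\pi\mu}\Gamma(\nu+\mu+1)(z^2-1)^{\frac12\mu}}{2^{\nu+1}z^{\nu+\mu+1}}{}_2\mathbf F_1\bigl(\tfrac{\nu+\mu+1}2,\tfrac{\nu+\mu+2}2;\nu+\tfrac32;\tfrac1{z^2}\bigr)$,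 $z\in\mathbb C\setminus(-\infty,1]$. Ferrers function of the second kind, for $x\in(-1,1)$: $\mathsf Q_\nu^\mu(x)=\frac{e^{-i\pi\mu}}2\bigl(e^{-\frac12i\pi\mu}Q_\nu^\mu(x+i0)+e^{\frac12i\pi\mu}Q_\nu^\mu(x-i0)\bigr)$. Both on-the-cut functions are extended from $(-1,1)$ to $\mathbb C\setminus((-\infty,-1]\cup[1,\infty))$ by analytic continuation. *)

theory Defs
  imports "HOL-Analysis.Analysis"
begin

definition neg_naturals :: "complex set"
  where "neg_naturals = {- of_nat n | n::nat. n \<ge> 1}"

(* Only used for a connected open S and a subset A of S that has a limit point in S, so that
   the continuation is unique on S by the identity theorem. Values outside S are unspecified. *)
definition analytic_continuation :: "complex set \<Rightarrow> complex set \<Rightarrow> (complex \<Rightarrow> complex) \<Rightarrow> complex \<Rightarrow> complex"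
  where "analytic_continuation A S f = (SOME g. g holomorphic_on S \<and> (\<forall>z\<in>A. g z = f z))"

(* f(x + i0) and f(x - i0) *)
definition boundary_above :: "(complex \<Rightarrow> complex) \<Rightarrow> real \<Rightarrow> complex"
  where "boundary_above f x = Lim (at_right 0) (\<lambda>\<epsilon>::real. f (Complex x \<epsilon>))"

definition boundary_below :: "(complex \<Rightarrow> complex) \<Rightarrow> real \<Rightarrow> complex"
  where "boundary_below f x = Lim (at_right 0) (\<lambda>\<epsilon>::real. f (Complex x (- \<epsilon>)))"

(* Olver's normalization: the Gauss hypergeometric function divided by Gamma c, entire in c *)
definition olver_series :: "complex \<Rightarrow> complex \<Rightarrow> complex \<Rightarrow> complex \<Rightarrow> complex"
  where "olver_series a b c z =
    (\<Sum>k. pochhammer a k * pochhammer b k * rGamma (c + of_nat k) * z ^ k / fact k)"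

definition olver_2F1 :: "complex \<Rightarrow> complex \<Rightarrow> complex \<Rightarrow> complex \<Rightarrow> complex"
  where "olver_2F1 a b c =
    analytic_continuation (ball 0 1) (- complex_of_real ` {1..}) (olver_series a b c)"

definition cut_domain :: "complex set"
  where "cut_domain = - complex_of_real ` ({..-1} \<union> {1..})"

(* Extends a function on (-1,1) to cut_domain. *)
definition continue_from_interval :: "(real \<Rightarrow> complex) \<Rightarrow> complex \<Rightarrow> complex"
  where "continue_from_interval f =
    analytic_continuation (complex_of_real ` {-1<..<1}) cut_domain (\<lambda>z. f (Re z))"

(* The argument of the hypergeometric function is 2 / (1 - z) (Szego 4.61.5); it avoids
   [1, \<infinity>) exactly when z is not in [-1, 1) (at z = 1 it is not defined).
   Meant for \<alpha> + \<gamma> and \<beta> + \<gamma> outside neg_naturals. *)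
definition jacobi_Q :: "complex \<Rightarrow> complex \<Rightarrow> complex \<Rightarrow> complex \<Rightarrow> complex"
  where "jacobi_Q \<gamma> \<alpha> \<beta> z =
    2 powr (\<alpha> + \<beta> + \<gamma>) * Gamma (\<alpha> + \<gamma> + 1) * Gamma (\<beta> + \<gamma> + 1) /
      ((z - 1) powr (\<alpha> + \<gamma> + 1) * (z + 1) powr \<beta>) *
    olver_2F1 (\<gamma> + 1) (\<alpha> + \<gamma> + 1) (\<alpha> + \<beta> + 2 * \<gamma> + 2) (2 / (1 - z))"

definition jacobi_Q_cut :: "complex \<Rightarrow> complex \<Rightarrow> complex \<Rightarrow> complex \<Rightarrow> complex"
  where "jacobi_Q_cut \<gamma> \<alpha> \<beta> = continue_from_interval (\<lambda>x.
    1 / 2 * (exp (\<i> * pi * \<alpha>) * boundary_above (jacobi_Q \<gamma> \<alpha> \<beta>) x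
           + exp (- \<i> * pi * \<alpha>) * boundary_below (jacobi_Q \<gamma> \<alpha> \<beta>) x))"

(* (z + 1) powr (\<mu> / 2) * (z - 1) powr (\<mu> / 2) is the convention for the power of z\<^sup>2 - 1; it
   differs from the principal power of z\<^sup>2 - 1 for Re z < 0.
   Meant for \<nu> + \<mu> outside neg_naturals. *)
definition legendre_Q :: "complex \<Rightarrow> complex \<Rightarrow> complex \<Rightarrow> complex"
  where "legendre_Q \<nu> \<mu> z =
    sqrt pi * exp (\<i> * pi * \<mu>) * Gamma (\<nu> + \<mu> + 1) * ((z + 1) powr (\<mu> / 2) * (z - 1) powr (\<mu> / 2)) /
      (2 powr (\<nu> + 1) * z powr (\<nu> + \<mu> + 1)) *
    olver_2F1 ((\<nu> + \<mu> + 1) / 2) ((\<nu> + \<mu> + 2) / 2) (\<nu> + 3 / 2) (1 / z\<^sup>2)"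

definition ferrers_Q :: "complex \<Rightarrow> complex \<Rightarrow> complex \<Rightarrow> complex"
  where "ferrers_Q \<nu> \<mu> = continue_from_interval (\<lambda>x.
    exp (- \<i> * pi * \<mu>) / 2 *
      (exp (- (1 / 2) * \<i> * pi * \<mu>) * boundary_above (legendre_Q \<nu> \<mu>) x
     + exp (1 / 2 * \<i> * pi * \<mu>) * boundary_below (legendre_Q \<nu> \<mu>) x))"

end

theory Submission
  imports Defs "HOL-Complex_Analysis.Complex_Analysis" "HOL-Real_Asymp.Real_Asymp"
begin

text \<open>
  Off the real axis all three identities are consequences of two classical transformations of the
  hypergeometric function. The argument \<open>w = 2 / (1 - z)\<close> of the Jacobi function satisfies
  \<open>w / (2 - w) = - 1 / z\<close>, so the quadratic transformation of \<open>2F1(a, b; 2b; w)\<close>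
  (\<open>olver_2F1_quadratic\<close>) produces exactly the argument \<open>1 / z\<^sup>2\<close> of the Legendre function. For
  the parameters \<open>(\<alpha>, \<alpha>)\<close> it applies at once. For \<open>(\<alpha>, - \<alpha>)\<close> it would give the Legendre
  function of order \<open>\<alpha>\<close>; a preceding Pfaff transformation (\<open>olver_2F1_pfaff\<close>), which replaces
  \<open>w\<close> by \<open>w / (w - 1) = 2 / (1 + z)\<close>, that is \<open>z\<close> by \<open>- z\<close>, turns this into the order \<open>- \<alpha>\<close>.
  The third identity is the second with \<open>- \<alpha>\<close> in place of \<open>\<alpha>\<close>.

  What remains is to show that all the objects exist: the continuation of the hypergeometric series
  to the slit plane, the one-sided limits on the cut, and the continuation of the averaged limits
  from \<open>(-1, 1)\<close>. Each of these is an instance of one principle, \<open>linear_ode2_continuation\<close>: on an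
  open starlike set on which the coefficients are holomorphic, every local holomorphic solution of
  \<open>y'' = p y' + q y\<close> extends to the whole set. The hypergeometric equation has
  singularities \<open>0\<close>, \<open>1\<close> and \<open>\<infinity>\<close> only. On the plane slit along \<open>(-\<infinity>, 0]\<close> and \<open>[1, \<infinity>)\<close> the
  principle continues the series, which with the Pfaff transformation gives the function on the
  plane slit along \<open>[1, \<infinity>)\<close>. On the plane slit along
  \<open>(-\<infinity>, 1]\<close> it continues the function from the upper (or lower) half-plane across \<open>(1, \<infinity>)\<close>;
  as \<open>z \<mapsto> 2 / (1 - z)\<close> maps the cut domain into that set, the Jacobi function on either half-plane is
  the restriction of a function holomorphic on the cut domain, whose values on \<open>(-1, 1)\<close> are the
  one-sided limits. The same then holds for the Legendre function, because it differs from
  the Jacobi function by an explicit factor. The degenerate case where this factor vanishes is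
  harmless, since there the Jacobi function is zero.
\<close>

section \<open>Linear differential equations of second order on starlike sets\<close>

lemma holomorphic_starlike_primitive_at:
  assumes S: "open S" "s0 \<in> S" "\<And>z. z \<in> S \<Longrightarrow> closed_segment s0 z \<subseteq> S"
    and f: "f holomorphic_on S"
  shows "\<exists>g. g s0 = (0::complex) \<and> (\<forall>z\<in>S. (g has_field_derivative f z) (at z))"
proof -
  have "starlike S" using S by (auto simp: starlike_def)
  then obtain g where g: "\<forall>z\<in>S. (g has_field_derivative f z) (at z)"
    using holomorphic_starlike_primitive[of S f "{}"] f S(1)
    by (auto simp: holomorphic_on_imp_continuous_on holomorphic_on_open field_differentiable_def)
  show ?thesis
    by (rule exI[of _ "\<lambda>z. g z - g s0"]) (use g in \<open>auto intro!: derivative_eq_intros\<close>)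
qed

text \<open>
  One Picard step along the ray \<open>t \<mapsto> s0 + t w\<close>: integrating a bound of order \<open>t ^ n / n!\<close> for the
  derivative yields one of order \<open>t ^ (n + 1) / (n + 1)!\<close>. The factorial is what makes the iteration
  converge on all of a starlike set and not only near its centre.
\<close>
lemma ray_bound_step:
  fixes u v :: "complex \<Rightarrow> complex"
  assumes der: "\<And>t. t \<in> {0..1} \<Longrightarrow> (u has_field_derivative v (s0 + of_real t * w)) (at (s0 + of_real t * w))"
    and u0: "u s0 = 0"
    and bnd: "\<And>t. t \<in> {0..1} \<Longrightarrow> norm (v (s0 + of_real t * w)) \<le> M * (C * (L * t) ^ n / fact n)"
    and L: "norm w * M \<le> L" "0 \<le> M" "0 \<le> C" "0 \<le> L" and t: "t \<in> {0..1}"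
  shows "norm (u (s0 + of_real t * w)) \<le> C * (L * t) ^ Suc n / fact (Suc n)"
proof (cases "t = 0")
  case True
  then show ?thesis by (simp add: u0)
next
  case False
  then have t0: "0 < t" "t \<le> 1" using t by auto
  let ?g = "\<lambda>r::real. u (s0 + of_real r * w)"
  let ?h = "\<lambda>r::real. C * (L * r) ^ Suc n / fact (Suc n)"
  have dg: "(?g has_vector_derivative (w * v (s0 + of_real r * w))) (at r)" if "r \<in> {0..1}" for r
  proof -
    have 1: "((\<lambda>r::real. s0 + of_real r * w) has_vector_derivative w) (at r)"
      by (auto intro!: derivative_eq_intros)
    show ?thesis
      using field_vector_diff_chain_at[OF 1 der[OF that]] by (simp add: o_def)
  qed
  have dh: "(?h has_vector_derivative (L * C * (L * r) ^ n / fact n)) (at r)" for r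
  proof -
    have "(?h has_field_derivative (C * (real (Suc n) * (L * r) ^ n * L) / fact (Suc n))) (at r)"
      by (rule derivative_eq_intros refl | simp)+
    also have "C * (real (Suc n) * (L * r) ^ n * L) / fact (Suc n) = L * C * (L * r) ^ n / fact n"
      by (simp add: divide_simps)
    finally show ?thesis by (simp add: has_real_derivative_iff_has_vector_derivative)
  qed
  have "norm (?g t - ?g 0) \<le> ?h t - ?h 0"
  proof (rule differentiable_bound_general[OF \<open>0 < t\<close>])
    show "continuous_on {0..t} ?g"
      using dg t0 by (force intro!: continuous_at_imp_continuous_on intro: has_vector_derivative_continuous)
    show "continuous_on {0..t} ?h" by (intro continuous_intros) auto
    fix r assume r: "0 < r" "r < t"
    then have r': "r \<in> {0..1}" using t0 by auto
    show "(?g has_vector_derivative (w * v (s0 + of_real r * w))) (at r)" using dg r' by blast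
    show "(?h has_vector_derivative (L * C * (L * r) ^ n / fact n)) (at r)" by (rule dh)
    have "norm (w * v (s0 + of_real r * w)) \<le> norm w * (M * (C * (L * r) ^ n / fact n))"
      unfolding norm_mult by (intro mult_left_mono bnd r') auto
    also have "\<dots> = norm w * M * (C * (L * r) ^ n / fact n)" by simp
    also have "\<dots> \<le> L * (C * (L * r) ^ n / fact n)"
      using L r by (intro mult_right_mono) auto
    finally show "norm (w * v (s0 + of_real r * w)) \<le> L * C * (L * r) ^ n / fact n"
      by simp
  qed
  then show ?thesis by (simp add: u0)
qed

text \<open>
  Picard iteration for the system \<open>u' = v\<close>, \<open>v' = p v + q u\<close>, written as a series of increments
  \<open>U n\<close>, \<open>V n\<close> each of which is a primitive, vanishing at \<open>s0\<close>, of the previous right-hand side.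
  Primitives of holomorphic functions exist on starlike sets, so every increment is
  holomorphic, and the ray bounds make the series locally dominated by an exponential series.
\<close>
lemma linear_ode2_initial_value:
  fixes p q :: "complex \<Rightarrow> complex"
  assumes S: "open S" "s0 \<in> S" "\<And>z. z \<in> S \<Longrightarrow> closed_segment s0 z \<subseteq> S"
    and p: "p holomorphic_on S" and q: "q holomorphic_on S"
  shows "\<exists>u v. u s0 = A \<and> v s0 = B \<and>
    (\<forall>z\<in>S. (u has_field_derivative v z) (at z) \<and>
            (v has_field_derivative (p z * v z + q z * u z)) (at z))"
proof -
  define prim where "prim f = (SOME g. g s0 = (0::complex) \<and>
    (\<forall>z\<in>S. (g has_field_derivative f z) (at z)))" for f
  have prim: "prim f s0 = 0" "\<And>z. z \<in> S \<Longrightarrow> (prim f has_field_derivative f z) (at z)"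
    if "f holomorphic_on S" for f
    using someI_ex[OF holomorphic_starlike_primitive_at[OF S that]] by (auto simp: prim_def)
  define UV where "UV = rec_nat (\<lambda>z. A, \<lambda>z. B)
    (\<lambda>_ (u, v). (prim v, prim (\<lambda>z. p z * v z + q z * u z)))"
  define U where "U n = fst (UV n)" for n
  define V where "V n = snd (UV n)" for n
  have U0: "U 0 = (\<lambda>z. A)" and V0: "V 0 = (\<lambda>z. B)"
    by (simp_all add: U_def V_def UV_def)
  have US: "U (Suc n) = prim (V n)" 
    and VS: "V (Suc n) = prim (\<lambda>z. p z * V n z + q z * U n z)" for n
    by (simp_all add: U_def V_def UV_def split: prod.split)
  have hol: "U n holomorphic_on S \<and> V n holomorphic_on S" for n
  proof (induction n)
    case 0 then show ?case by (simp add: U0 V0)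
  next
    case (Suc n)
    then have h: "V n holomorphic_on S" "(\<lambda>z. p z * V n z + q z * U n z) holomorphic_on S"
      using p q by (auto intro!: holomorphic_intros)
    show ?case unfolding US VS
      using prim(2)[OF h(1)] prim(2)[OF h(2)] S(1) by (auto simp: holomorphic_on_open)
  qed
  have dU: "(U (Suc n) has_field_derivative V n z) (at z)" if "z \<in> S" for n z
    unfolding US using hol[of n] that by (intro prim) auto
  have dV: "(V (Suc n) has_field_derivative (p z * V n z + q z * U n z)) (at z)" if "z \<in> S" for n z
    unfolding VS using hol[of n] that p q by (intro prim) (auto intro!: holomorphic_intros)
  have Us0: "U (Suc n) s0 = 0" and Vs0: "V (Suc n) s0 = 0" for n
    unfolding US VS using hol[of n] p q by (auto intro!: prim(1) holomorphic_intros)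
  \<comment> \<open>The derivatives of the increments: zero for the constant initial ones, so the two series of
    derivatives are the right-hand sides of the system shifted by one index.\<close>
  define U' where "U' n = (case n of 0 \<Rightarrow> (\<lambda>z. 0) | Suc n \<Rightarrow> V n)" for n
  define V' where "V' n = (case n of 0 \<Rightarrow> (\<lambda>z. 0) | Suc n \<Rightarrow> (\<lambda>z. p z * V n z + q z * U n z))" for n
  have dU': "(U n has_field_derivative U' n z) (at z)" if "z \<in> S" for n z
    using dU that by (cases n) (auto simp: U'_def U0)
  have dV': "(V n has_field_derivative V' n z) (at z)" if "z \<in> S" for n z
    using dV that by (cases n) (auto simp: V'_def V0)
  have dom: "\<exists>d h. 0 < d \<and> summable h \<and>
      (\<forall>n. \<forall>y\<in>ball x d \<inter> S. norm (U n y) \<le> h n \<and> norm (V n y) \<le> h n)" if x: "x \<in> S" for x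
  proof -
    obtain d where d: "d > 0" "cball x d \<subseteq> S"
      using x S(1) open_contains_cball by blast
    define K where "K = (\<lambda>(t, z). s0 + complex_of_real t * (z - s0)) ` ({0..1} \<times> cball x d)"
    have "continuous_on ({0..1} \<times> cball x d) (\<lambda>(t, z). s0 + complex_of_real t * (z - s0))"
      unfolding split_def by (intro continuous_intros)
    then have "compact K" unfolding K_def
      by (rule compact_continuous_image) (intro compact_Times compact_Icc compact_cball)
    have inK: "s0 + complex_of_real t * (z - s0) \<in> K" if "t \<in> {0..1}" "z \<in> cball x d" for t z
      using that by (force simp: K_def)
    have "K \<subseteq> S"
    proof
      fix y assume "y \<in> K"
      then obtain t z where t: "t \<in> {0..1}" "z \<in> cball x d" "y = s0 + complex_of_real t * (z - s0)"
        by (auto simp: K_def)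
      then have "y \<in> closed_segment s0 z"
        by (auto simp: closed_segment_def scaleR_conv_of_real algebra_simps intro!: exI[of _ t])
      then show "y \<in> S" using S(3) d t by blast
    qed
    have "bounded (p ` K)" "bounded (q ` K)"
      using \<open>compact K\<close> p q holomorphic_on_subset[OF _ \<open>K \<subseteq> S\<close>]
      by (auto intro!: compact_imp_bounded compact_continuous_image holomorphic_on_imp_continuous_on)
    then obtain M1 M2 where M: "\<And>y. y \<in> K \<Longrightarrow> norm (p y) \<le> M1" "\<And>y. y \<in> K \<Longrightarrow> norm (q y) \<le> M2"
      by (auto simp: bounded_iff)
    \<comment> \<open>The summand 1 accounts for the equation \<open>u' = v\<close>.\<close>
    define m where "m = 1 + \<bar>M1\<bar> + \<bar>M2\<bar>"
    define C where "C = norm A + norm B"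
    define L where "L = (norm (x - s0) + d) * m"
    have m: "m \<ge> 1" and C: "C \<ge> 0" and L: "L \<ge> 0" using d by (auto simp: m_def C_def L_def)
    have wL: "norm (z - s0) * m \<le> L" if "z \<in> cball x d" for z
    proof -
      have "norm (z - s0) \<le> norm (x - s0) + norm (z - x)"
        using norm_triangle_ineq[of "x - s0" "z - x"] by simp
      then have "norm (z - s0) \<le> norm (x - s0) + d"
        using that by (simp add: dist_norm norm_minus_commute)
      then show ?thesis unfolding L_def using m by (intro mult_right_mono) auto
    qed
    have bnd: "norm (U n (s0 + of_real t * (z - s0))) \<le> C * (L * t) ^ n / fact n \<and>
               norm (V n (s0 + of_real t * (z - s0))) \<le> C * (L * t) ^ n / fact n"
      if "t \<in> {0..1}" and z: "z \<in> cball x d" for n t z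
      using that(1)
    proof (induction n arbitrary: t)
      case 0
      then show ?case by (auto simp: U0 V0 C_def)
    next
      case (Suc n)
      let ?y = "\<lambda>t. s0 + complex_of_real t * (z - s0)"
      have nn: "0 \<le> C * (L * t) ^ n / fact n" if "t \<in> {0..1}" for t
        using that C L by auto
      have bV: "norm (V n (?y t)) \<le> m * (C * (L * t) ^ n / fact n)" if t: "t \<in> {0..1}" for t
      proof -
        have "norm (V n (?y t)) \<le> 1 * (C * (L * t) ^ n / fact n)" using Suc.IH[OF t] by simp
        also have "\<dots> \<le> m * (C * (L * t) ^ n / fact n)"
          by (intro mult_right_mono nn t m)
        finally show ?thesis .
      qed
      have bW: "norm (p (?y t) * V n (?y t) + q (?y t) * U n (?y t)) \<le> m * (C * (L * t) ^ n / fact n)"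
        if t: "t \<in> {0..1}" for t
      proof -
        let ?b = "C * (L * t) ^ n / fact n"
        have "norm (p (?y t) * V n (?y t) + q (?y t) * U n (?y t))
             \<le> norm (p (?y t)) * norm (V n (?y t)) + norm (q (?y t)) * norm (U n (?y t))"
          by (metis norm_mult norm_triangle_ineq)
        also have "\<dots> \<le> \<bar>M1\<bar> * ?b + \<bar>M2\<bar> * ?b"
          using M(1)[OF inK[OF t z]] M(2)[OF inK[OF t z]] Suc.IH[OF t]
          by (intro add_mono mult_mono) auto
        also have "\<dots> = (\<bar>M1\<bar> + \<bar>M2\<bar>) * ?b" by (simp only: distrib_right)
        also have "\<dots> \<le> m * ?b" by (intro mult_right_mono nn t) (auto simp: m_def)
        finally show ?thesis .
      qed
      have inS: "?y t \<in> S" if "t \<in> {0..1}" for t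
        using inK[OF that z] \<open>K \<subseteq> S\<close> by blast
      have m0: "0 \<le> m" using m by simp
      show ?case
      proof
        show "norm (U (Suc n) (?y t)) \<le> C * (L * t) ^ Suc n / fact (Suc n)"
          by (rule ray_bound_step[where v = "V n", OF dU[OF inS] Us0 bV wL[OF z] m0 C L Suc.prems])
        show "norm (V (Suc n) (?y t)) \<le> C * (L * t) ^ Suc n / fact (Suc n)"
          by (rule ray_bound_step[where v = "\<lambda>z. p z * V n z + q z * U n z", OF dV[OF inS] Vs0 bW wL[OF z] m0 C L Suc.prems])
      qed
    qed
    have "summable (\<lambda>n. C * L ^ n / fact n)"
      using summable_mult[OF summable_exp[of L], of C] by (simp add: field_simps)
    moreover have "\<forall>n. \<forall>y\<in>ball x d \<inter> S. norm (U n y) \<le> C * L ^ n / fact n \<and> norm (V n y) \<le> C * L ^ n / fact n"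
      using bnd[of 1] by auto
    ultimately show ?thesis using d(1) by blast
  qed
  have domU: "\<exists>d h. 0 < d \<and> summable h \<and>
      (\<forall>\<^sub>F n in sequentially. \<forall>y\<in>ball x d \<inter> S. norm (U n y) \<le> h n)"
    and domV: "\<exists>d h. 0 < d \<and> summable h \<and>
      (\<forall>\<^sub>F n in sequentially. \<forall>y\<in>ball x d \<inter> S. norm (V n y) \<le> h n)" if "x \<in> S" for x
    using dom[OF that] by (elim exE conjE, intro exI conjI always_eventually allI; blast)+
  obtain u u' where u: "\<And>x. x \<in> S \<Longrightarrow> (\<lambda>n. U n x) sums u x" "\<And>x. x \<in> S \<Longrightarrow> (\<lambda>n. U' n x) sums u' x"
      "\<And>x. x \<in> S \<Longrightarrow> (u has_field_derivative u' x) (at x)"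
    using series_and_derivative_comparison_local[of S U U', OF S(1) dU' domU] by blast
  obtain v v' where v: "\<And>x. x \<in> S \<Longrightarrow> (\<lambda>n. V n x) sums v x" "\<And>x. x \<in> S \<Longrightarrow> (\<lambda>n. V' n x) sums v' x"
      "\<And>x. x \<in> S \<Longrightarrow> (v has_field_derivative v' x) (at x)"
    using series_and_derivative_comparison_local[of S V V', OF S(1) dV' domV] by blast
  have u'v: "u' x = v x" if "x \<in> S" for x
  proof -
    have "(\<lambda>n. U' (Suc n) x) sums v x" using v(1)[OF that] by (simp add: U'_def)
    then have "(\<lambda>n. U' n x) sums v x"
      by (subst (asm) sums_Suc_iff) (simp add: U'_def)
    then show ?thesis using u(2)[OF that] sums_unique2 by blast
  qed
  have v'uv: "v' x = p x * v x + q x * u x" if "x \<in> S" for x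
  proof -
    have "(\<lambda>n. V' (Suc n) x) sums (p x * v x + q x * u x)" using v(1)[OF that] u(1)[OF that]
      by (simp add: V'_def sums_add sums_mult)
    then have "(\<lambda>n. V' n x) sums (p x * v x + q x * u x)"
      by (subst (asm) sums_Suc_iff) (simp add: V'_def)
    then show ?thesis using v(2)[OF that] sums_unique2 by blast
  qed
  have "u s0 = A" "v s0 = B"
  proof -
    have "(\<lambda>n. U n s0) sums A" using sums_Suc_iff[of "\<lambda>n. U n s0" 0] by (simp add: Us0 U0)
    then show "u s0 = A" using u(1)[OF S(2)] sums_unique2 by blast
    have "(\<lambda>n. V n s0) sums B" using sums_Suc_iff[of "\<lambda>n. V n s0" 0] by (simp add: Vs0 V0)
    then show "v s0 = B" using v(1)[OF S(2)] sums_unique2 by blast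
  qed
  then show ?thesis using u(3) v(3) u'v v'uv by (intro exI[of _ u] exI[of _ v]) auto
qed

text \<open>
  The Wronskian satisfies \<open>W' = p W\<close>, so with a primitive \<open>P\<close> of \<open>p\<close> the product \<open>W exp (- P)\<close> has derivative zero.
\<close>
lemma wronskian_deriv:
  fixes p q :: "complex \<Rightarrow> complex"
  assumes "(u1 has_field_derivative v1 z) (at z)" "(v1 has_field_derivative (p z * v1 z + q z * u1 z)) (at z)"
    and "(u2 has_field_derivative v2 z) (at z)" "(v2 has_field_derivative (p z * v2 z + q z * u2 z)) (at z)"
    and "(P has_field_derivative p z) (at z)"
  shows "((\<lambda>z. (u1 z * v2 z - v1 z * u2 z) * exp (- P z)) has_field_derivative 0) (at z)"
  by (rule derivative_eq_intros assms refl)+ (simp add: algebra_simps)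

lemma wronskian_constant:
  fixes p q :: "complex \<Rightarrow> complex"
  assumes T: "open T" "connected T"
    and "\<And>z. z \<in> T \<Longrightarrow> (u1 has_field_derivative v1 z) (at z)"
      "\<And>z. z \<in> T \<Longrightarrow> (v1 has_field_derivative (p z * v1 z + q z * u1 z)) (at z)"
      "\<And>z. z \<in> T \<Longrightarrow> (u2 has_field_derivative v2 z) (at z)"
      "\<And>z. z \<in> T \<Longrightarrow> (v2 has_field_derivative (p z * v2 z + q z * u2 z)) (at z)"
      "\<And>z. z \<in> T \<Longrightarrow> (P has_field_derivative p z) (at z)"
  shows "\<exists>c. \<forall>z\<in>T. (u1 z * v2 z - v1 z * u2 z) * exp (- P z) = c"
proof -
  let ?f = "\<lambda>z. (u1 z * v2 z - v1 z * u2 z) * exp (- P z)"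
  have d: "(?f has_field_derivative 0) (at z)" if "z \<in> T" for z
    by (rule wronskian_deriv[where p = p and q = q]) (use assms that in blast)+
  obtain c where "\<And>z. z \<in> T \<Longrightarrow> ?f z = c"
  proof (rule DERIV_zero_connected_constant[OF T(2,1), of "{}" ?f])
    show "continuous_on T ?f" using d T(1)
      by (intro holomorphic_on_imp_continuous_on) (auto simp: holomorphic_on_open)
  qed (use d in auto)
  then show ?thesis by blast
qed

text \<open>
  Take the fundamental solutions with initial values \<open>(1, 0)\<close> and \<open>(0, 1)\<close> at \<open>s0\<close>. By Cramer's rule
  \<open>y\<close> is a combination of them whose coefficients are quotients of Wronskians; these are constant on
  \<open>T\<close> up to the common factor \<open>exp P\<close>, so the same combination defines the extension. Later \<open>T\<close> is a
  half-plane and \<open>S\<close> a slit plane, starlike with respect to real points only, so that Picard iteration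
  could not start in \<open>T\<close>.
\<close>
lemma linear_ode2_continuation:
  fixes p q y y' :: "complex \<Rightarrow> complex"
  assumes S: "open S" "s0 \<in> S" "\<And>z. z \<in> S \<Longrightarrow> closed_segment s0 z \<subseteq> S"
    and p: "p holomorphic_on S" and q: "q holomorphic_on S"
    and T: "open T" "connected T" "T \<subseteq> S"
    and y: "\<And>z. z \<in> T \<Longrightarrow> (y has_field_derivative y' z) (at z)"
      "\<And>z. z \<in> T \<Longrightarrow> (y' has_field_derivative (p z * y' z + q z * y z)) (at z)"
  shows "\<exists>Y. Y holomorphic_on S \<and> (\<forall>z\<in>T. Y z = y z)"
proof -
  obtain u1 v1 where s1: "u1 s0 = 1" "v1 s0 = 0"
    "\<And>z. z \<in> S \<Longrightarrow> (u1 has_field_derivative v1 z) (at z)"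
    "\<And>z. z \<in> S \<Longrightarrow> (v1 has_field_derivative (p z * v1 z + q z * u1 z)) (at z)"
    using linear_ode2_initial_value[OF S p q, of 1 0] by blast
  obtain u2 v2 where s2: "u2 s0 = 0" "v2 s0 = 1"
    "\<And>z. z \<in> S \<Longrightarrow> (u2 has_field_derivative v2 z) (at z)"
    "\<And>z. z \<in> S \<Longrightarrow> (v2 has_field_derivative (p z * v2 z + q z * u2 z)) (at z)"
    using linear_ode2_initial_value[OF S p q, of 0 1] by blast
  obtain P where P: "P s0 = 0" "\<And>z. z \<in> S \<Longrightarrow> (P has_field_derivative p z) (at z)"
    using holomorphic_starlike_primitive_at[OF S p] by blast
  have "starlike S" using S by (auto simp: starlike_def)
  then have conS: "connected S" by (rule starlike_imp_connected)
  have "\<exists>c. \<forall>z\<in>S. (u1 z * v2 z - v1 z * u2 z) * exp (- P z) = c"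
    using S s1 s2 P by (intro wronskian_constant[OF S(1) conS, where p = p and q = q]) auto
  then obtain c where c: "\<And>z. z \<in> S \<Longrightarrow> (u1 z * v2 z - v1 z * u2 z) * exp (- P z) = c" by blast
  have "c = 1" using c[OF S(2)] s1 s2 P by simp
  then have W1: "(u1 z * v2 z - v1 z * u2 z) * exp (- P z) = 1" if "z \<in> S" for z
    using c[OF that] by simp
  have "\<exists>c. \<forall>z\<in>T. (y z * v2 z - y' z * u2 z) * exp (- P z) = c"
    by (rule wronskian_constant[OF T(1,2), where p = p and q = q]) (use y s2 P T(3) in blast)+
  then obtain c1 where c1: "\<And>z. z \<in> T \<Longrightarrow> (y z * v2 z - y' z * u2 z) * exp (- P z) = c1" by blast
  have "\<exists>c. \<forall>z\<in>T. (u1 z * y' z - v1 z * y z) * exp (- P z) = c"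
    by (rule wronskian_constant[OF T(1,2), where p = p and q = q]) (use y s1 P T(3) in blast)+
  then obtain c2 where c2: "\<And>z. z \<in> T \<Longrightarrow> (u1 z * y' z - v1 z * y z) * exp (- P z) = c2" by blast
  have "c1 * u1 z + c2 * u2 z = y z" if "z \<in> T" for z
  proof -
    have "c1 * u1 z + c2 * u2 z = y z * ((u1 z * v2 z - v1 z * u2 z) * exp (- P z))"
      unfolding c1[OF that, symmetric] c2[OF that, symmetric] by (simp add: algebra_simps)
    then show ?thesis using W1 that T(3) by auto
  qed
  moreover have "(\<lambda>z. c1 * u1 z + c2 * u2 z) holomorphic_on S"
    using s1(3) s2(3) S(1) by (intro holomorphic_intros) (auto simp: holomorphic_on_open)
  ultimately show ?thesis by blast
qed

section \<open>The hypergeometric series and its differential equation\<close>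

definition olver_fps :: "complex \<Rightarrow> complex \<Rightarrow> complex \<Rightarrow> complex fps"
  where "olver_fps a b c = Abs_fps (\<lambda>k. pochhammer a k * pochhammer b k * rGamma (c + of_nat k) / fact k)"

lemma olver_fps_nth: "fps_nth (olver_fps a b c) k = pochhammer a k * pochhammer b k * rGamma (c + of_nat k) / fact k"
  by (simp add: olver_fps_def)

lemma olver_series_eq_eval_fps: "olver_series a b c z = eval_fps (olver_fps a b c) z"
  by (simp add: olver_series_def eval_fps_def olver_fps_def)

text \<open>
  The recurrence is not divided by \<open>c + n\<close>: in this form it holds for every \<open>c\<close>, including the
  nonpositive integers at which initial coefficients vanish.
\<close>
lemma olver_fps_rec:
  "of_nat (Suc n) * (c + of_nat n) * fps_nth (olver_fps a b c) (Suc n)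
     = (a + of_nat n) * (b + of_nat n) * fps_nth (olver_fps a b c) n"
proof -
  have "(c + of_nat n) * rGamma (c + of_nat (Suc n)) = rGamma (c + of_nat n)"
    using rGamma_plus1[of "c + of_nat n"] by (simp add: algebra_simps)
  then have "(a + of_nat n) * (b + of_nat n) * fps_nth (olver_fps a b c) n
     = (a + of_nat n) * (b + of_nat n) * (pochhammer a n * pochhammer b n *
        ((c + of_nat n) * rGamma (c + of_nat (Suc n))) / fact n)"
    by (simp add: olver_fps_nth)
  also have "\<dots> = of_nat (Suc n) * (c + of_nat n) * fps_nth (olver_fps a b c) (Suc n)"
    unfolding olver_fps_nth pochhammer_Suc fact_Suc
    by (simp del: of_nat_Suc add: field_simps)
  finally show ?thesis by simp
qed

lemma olver_fps_conv_radius: "fps_conv_radius (olver_fps a b c) \<ge> 1"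
  unfolding fps_conv_radius_def
proof (rule conv_radius_geI_ex')
  fix r :: real assume r: "0 < r" "ereal r < 1"
  let ?f = "fps_nth (olver_fps a b c)"
  define A B C where "A = norm a" and "B = norm b" and "C = norm c"
  \<comment> \<open>The ratio of consecutive terms tends to \<open>r\<close>, hence is eventually below any \<open>\<rho>\<close> strictly between \<open>r\<close> and 1.\<close>
  define \<rho> where "\<rho> = (1 + r) / 2"
  have \<rho>: "r < \<rho>" "\<rho> < 1" "1 < \<rho> / r" using r by (auto simp: \<rho>_def field_simps)
  have "((\<lambda>n. (A + real n) * (B + real n) / ((real n + 1) * (real n - C))) \<longlongrightarrow> 1) sequentially"
    by real_asymp
  then have "eventually (\<lambda>n. (A + real n) * (B + real n) / ((real n + 1) * (real n - C)) < \<rho> / r) sequentially"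
    using \<rho>(3) by (rule order_tendstoD)
  moreover have "eventually (\<lambda>n. real n > C) sequentially" by real_asymp
  ultimately have "eventually (\<lambda>n. norm (?f (Suc n) * of_real r ^ Suc n) \<le> \<rho> * norm (?f n * of_real r ^ n)) sequentially"
  proof eventually_elim
    case (elim n)
    have pos: "(real n + 1) * (real n - C) > 0" using elim by simp
    have le: "(A + real n) * (B + real n) * r \<le> \<rho> * ((real n + 1) * (real n - C))"
      using elim(1) pos r(1) by (simp add: divide_simps mult_ac split: if_splits)
    have n1: "norm (a + of_nat n) \<le> A + real n" "norm (b + of_nat n) \<le> B + real n"
      using norm_triangle_ineq[of a "of_nat n"] norm_triangle_ineq[of b "of_nat n"]
      by (simp_all add: A_def B_def)
    have n2: "real n - C \<le> norm (c + of_nat n)"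
      using norm_triangle_ineq[of "c + of_nat n" "- c"] by (simp add: C_def)
    let ?N = "norm (?f n)" and ?N' = "norm (?f (Suc n))"
    have eq: "(real n + 1) * norm (c + of_nat n) * ?N' = norm (a + of_nat n) * norm (b + of_nat n) * ?N"
    proof -
      have "norm (of_nat (Suc n) * (c + of_nat n) * ?f (Suc n))
        = norm ((a + of_nat n) * (b + of_nat n) * ?f n)" by (simp only: olver_fps_rec)
      then show ?thesis by (simp only: norm_mult norm_of_nat) (simp add: add.commute)
    qed
    have "(real n + 1) * (real n - C) * (?N' * r) \<le> ((real n + 1) * norm (c + of_nat n)) * (?N' * r)"
      using n2 r(1) by (intro mult_right_mono mult_left_mono) auto
    also have "\<dots> = norm (a + of_nat n) * norm (b + of_nat n) * (?N * r)"
      using eq by (simp add: mult.assoc[symmetric])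
    also have "\<dots> \<le> (A + real n) * (B + real n) * (?N * r)"
      using n1 r(1) by (intro mult_right_mono mult_mono) (auto simp: A_def)
    also have "\<dots> = ((A + real n) * (B + real n) * r) * ?N" by simp
    also have "\<dots> \<le> (\<rho> * ((real n + 1) * (real n - C))) * ?N"
      by (intro mult_right_mono le) auto
    also have "\<dots> = (real n + 1) * (real n - C) * (\<rho> * ?N)" by simp
    finally have "?N' * r \<le> \<rho> * ?N" using pos by (simp only: mult_le_cancel_left_pos)
    then have "?N' * r * r ^ n \<le> \<rho> * ?N * r ^ n" using r(1) by (intro mult_right_mono) auto
    then show ?case using r(1) by (simp add: norm_mult norm_power mult_ac)
  qed
  then obtain N where "\<And>n. n \<ge> N \<Longrightarrow> norm (?f (Suc n) * of_real r ^ Suc n) \<le> \<rho> * norm (?f n * of_real r ^ n)"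
    by (auto simp: eventually_at_top_linorder)
  then show "summable (\<lambda>n. ?f n * of_real r ^ n)"
    by (rule summable_ratio_test[OF \<rho>(2)])
qed

lemma olver_fps_ode:
  fixes a b c :: complex
  defines "F \<equiv> olver_fps a b c"
  shows "fps_X * fps_deriv (fps_deriv F) + fps_const c * fps_deriv F
    = fps_X * (fps_X * fps_deriv (fps_deriv F)) + fps_const (a + b + 1) * (fps_X * fps_deriv F) + fps_const (a * b) * F"
proof (rule fps_ext)
  fix n
  show "fps_nth (fps_X * fps_deriv (fps_deriv F) + fps_const c * fps_deriv F) n
     = fps_nth (fps_X * (fps_X * fps_deriv (fps_deriv F)) + fps_const (a + b + 1) * (fps_X * fps_deriv F) + fps_const (a * b) * F) n"
  proof (cases n)
    case 0
    then show ?thesis using olver_fps_rec[of 0 c a b] by (simp add: F_def)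
  next
    case (Suc m)
    then show ?thesis using olver_fps_rec[of n c a b]
      by (cases m) (simp_all add: F_def algebra_simps)
  qed
qed

text \<open>
  The hypergeometric differential equation \<open>z (1 - z) y'' + (c - (a + b + 1) z) y' - a b y = 0\<close>.
\<close>
lemma olver_series_ode:
  "\<exists>y' y''. \<forall>z\<in>ball 0 1. (olver_series a b c has_field_derivative y' z) (at z) \<and>
     (y' has_field_derivative y'' z) (at z) \<and>
     z * (1 - z) * y'' z = ((a + b + 1) * z - c) * y' z + a * b * olver_series a b c z"
proof -
  define F where "F = olver_fps a b c"
  have R: "fps_conv_radius F \<ge> 1" "fps_conv_radius (fps_deriv F) \<ge> 1" "fps_conv_radius (fps_deriv (fps_deriv F)) \<ge> 1"
    using olver_fps_conv_radius[of a b c] fps_conv_radius_deriv[of F] fps_conv_radius_deriv[of "fps_deriv F"]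
    unfolding F_def by (auto intro: order_trans)
  have XR: "fps_conv_radius (fps_X * G) \<ge> 1" if "fps_conv_radius G \<ge> 1" for G :: "complex fps"
    using order_trans[OF _ fps_conv_radius_mult[of fps_X G], of 1] that by simp
  have CR: "fps_conv_radius (fps_const k * G) \<ge> 1" if "fps_conv_radius G \<ge> 1" for k and G :: "complex fps"
    using order_trans[OF _ fps_conv_radius_mult[of "fps_const k" G], of 1] that by simp
  have AR: "fps_conv_radius (G + H) \<ge> 1" if "fps_conv_radius G \<ge> 1" "fps_conv_radius H \<ge> 1" for G H :: "complex fps"
    using order_trans[OF _ fps_conv_radius_add[of G H], of 1] that by simp
  have lt: "ereal (norm z) < fps_conv_radius G" if "z \<in> ball 0 1" "fps_conv_radius G \<ge> 1" for z and G :: "complex fps"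
    using that by (metis dist_0_norm less_le_trans mem_ball ereal_less(3))
  show ?thesis
  proof (rule exI[of _ "eval_fps (fps_deriv F)"], rule exI[of _ "eval_fps (fps_deriv (fps_deriv F))"], intro ballI conjI)
    fix z :: complex assume z: "z \<in> ball 0 1"
    show "(olver_series a b c has_field_derivative eval_fps (fps_deriv F) z) (at z)"
      unfolding olver_series_eq_eval_fps[abs_def] F_def[symmetric]
      by (intro has_field_derivative_eval_fps lt z R)
    show "(eval_fps (fps_deriv F) has_field_derivative eval_fps (fps_deriv (fps_deriv F)) z) (at z)"
      by (intro has_field_derivative_eval_fps lt z R)
    note L = lt[OF z]
    have "eval_fps (fps_X * fps_deriv (fps_deriv F) + fps_const c * fps_deriv F) z
      = eval_fps (fps_X * (fps_X * fps_deriv (fps_deriv F)) + fps_const (a + b + 1) * (fps_X * fps_deriv F) + fps_const (a * b) * F) z"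
      unfolding F_def olver_fps_ode ..
    then show "z * (1 - z) * eval_fps (fps_deriv (fps_deriv F)) z
        = ((a + b + 1) * z - c) * eval_fps (fps_deriv F) z + a * b * olver_series a b c z"
      by (simp add: eval_fps_add eval_fps_mult L R XR CR AR olver_series_eq_eval_fps F_def[symmetric])
         (simp add: algebra_simps)
  qed
qed

lemma olver_series_holomorphic: "olver_series a b c holomorphic_on ball 0 1"
proof -
  have "\<exists>y'. \<forall>z\<in>ball 0 1. (olver_series a b c has_field_derivative y' z) (at z)"
    using olver_series_ode[of a b c] by blast
  then show ?thesis by (auto simp: holomorphic_on_open)
qed

lemma olver_series_has_fps_expansion: "olver_series a b c has_fps_expansion olver_fps a b c"
  unfolding olver_series_eq_eval_fps[abs_def]
  by (intro eval_fps_has_fps_expansion less_le_trans[OF _ olver_fps_conv_radius]) simp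

section \<open>Pfaff and quadratic transformations of the series\<close>

text \<open>
  The expansion of \<open>(1 - x) powr (- a)\<close> at the origin.
\<close>
definition binom_fps :: "complex \<Rightarrow> complex fps"
  where "binom_fps a = Abs_fps (\<lambda>n. pochhammer a n / fact n)"

lemma binom_fps_nth: "fps_nth (binom_fps a) n = pochhammer a n / fact n"
  by (simp add: binom_fps_def)

lemma binom_fps_conv_compose: "binom_fps a = fps_compose (fps_binomial (-a)) (- fps_X)"
proof -
  have "- fps_X = fps_const (-1) * (fps_X :: complex fps)"
    by (simp flip: fps_const_neg)
  show ?thesis unfolding \<open>- fps_X = _\<close>
    by (intro fps_ext) (simp add: binom_fps_nth fps_compose_linear gbinomial_pochhammer mult.assoc[symmetric] power_mult_distrib[symmetric])
qed

lemma binom_fps_add: "binom_fps (a + b) = binom_fps a * binom_fps b"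
  unfolding binom_fps_conv_compose
  by (simp add: fps_compose_mult_distrib[symmetric] fps_binomial_add_mult[symmetric])

lemma binom_fps_power: "binom_fps a ^ n = binom_fps (of_nat n * a)"
proof (induction n)
  case 0
  show ?case by (rule fps_ext) (simp add: binom_fps_nth pochhammer_0_left)
qed (simp add: binom_fps_add ring_distribs)

lemma has_fps_expansion_one_minus_powr: "(\<lambda>x. (1 - x) powr (-a)) has_fps_expansion binom_fps a"
proof -
  have "((\<lambda>x. (1 + x) powr (-a)) \<circ> (\<lambda>x. - x)) has_fps_expansion fps_compose (fps_binomial (-a)) (- fps_X)"
    by (intro has_fps_expansion_compose fps_expansion_intros) simp_all
  then show ?thesis by (simp add: o_def binom_fps_conv_compose)
qed

lemma has_fps_expansion_moebius: "(\<lambda>x. x / (1 - x)) has_fps_expansion fps_X * binom_fps 1"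
proof -
  have "(\<lambda>x::complex. x * (1 - x) powr (-1)) has_fps_expansion fps_X * binom_fps 1"
    by (intro fps_expansion_intros has_fps_expansion_one_minus_powr)
  moreover have "eventually (\<lambda>x::complex. x * (1 - x) powr (-1) = x / (1 - x)) (nhds 0)"
    by (auto simp: powr_minus divide_inverse intro!: always_eventually)
  ultimately show ?thesis
    using has_fps_expansion_cong by fast
qed

text \<open>
  Both transformations have the shape \<open>F (s (x / (1 - x)) ^ d) (1 - x) powr (- a)\<close>, with \<open>d = 1\<close>, \<open>s = -1\<close> for
  Pfaff and \<open>d = 2\<close>, \<open>s = 1\<close> for the quadratic one. Since \<open>(x / (1 - x)) ^ j (1 - x) powr (- a)\<close> is
  \<open>x ^ j (1 - x) powr (- a - j)\<close>, the coefficients of such a function are explicit finite sums.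
\<close>
lemma fps_compose_moebius_binom_nth:
  fixes F :: "complex fps"
  assumes d: "d \<ge> 1"
  shows "fps_nth (fps_compose F (fps_const s * (fps_X * binom_fps 1) ^ d) * binom_fps a) n =
    (\<Sum>i=0..n. fps_nth F i * s ^ i *
      (if d * i \<le> n then pochhammer (a + of_nat (d * i)) (n - d * i) / fact (n - d * i) else 0))"
proof -
  define K where "K = fps_const s * (fps_X * binom_fps 1) ^ d"
  have K0: "fps_nth K 0 = 0" using d by (simp add: K_def fps_nth_power_0)
  have Kpow: "K ^ i * binom_fps a = fps_const (s ^ i) * (fps_X ^ (d * i) * binom_fps (a + of_nat (d * i)))" for i
    by (simp add: K_def power_mult_distrib power_mult[symmetric] binom_fps_power binom_fps_add fps_const_power mult_ac)
  have low: "fps_nth (K ^ i) j = 0" if "j < i" for i j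
    using startsby_zero_power_prefix[OF K0] that by blast
  have "fps_nth (fps_compose F K * binom_fps a) n
     = (\<Sum>j=0..n. (\<Sum>i=0..j. fps_nth F i * fps_nth (K ^ i) j) * fps_nth (binom_fps a) (n - j))"
    by (simp add: fps_mult_nth fps_compose_nth)
  also have "\<dots> = (\<Sum>j=0..n. (\<Sum>i=0..n. fps_nth F i * fps_nth (K ^ i) j) * fps_nth (binom_fps a) (n - j))"
    by (intro sum.cong refl arg_cong2[where f = "(*)"] sum.mono_neutral_left) (auto simp: low)
  also have "\<dots> = (\<Sum>i=0..n. fps_nth F i * (\<Sum>j=0..n. fps_nth (K ^ i) j * fps_nth (binom_fps a) (n - j)))"
    unfolding sum_distrib_left sum_distrib_right by (subst sum.swap) (simp add: mult.assoc)
  also have "\<dots> = (\<Sum>i=0..n. fps_nth F i * fps_nth (K ^ i * binom_fps a) n)"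
    by (simp add: fps_mult_nth)
  also have "\<dots> = (\<Sum>i=0..n. fps_nth F i * s ^ i *
      (if d * i \<le> n then pochhammer (a + of_nat (d * i)) (n - d * i) / fact (n - d * i) else 0))"
    unfolding Kpow by (intro sum.cong refl) (auto simp: fps_X_power_mult_nth binom_fps_nth simp del: of_nat_mult)
  finally show ?thesis by (simp add: K_def)
qed

text \<open>
  The Chu-Vandermonde sum, normalized by \<open>1 / Gamma\<close> so that no condition on \<open>c\<close> arises. Pascal's rule
  reduces the sum for \<open>n + 1\<close> to those for \<open>n\<close> at \<open>(B, c)\<close> and \<open>(B + 1, c + 1)\<close>.
\<close>
lemma chu_vandermonde_rGamma:
  fixes B c :: complex
  shows "(\<Sum>i=0..n. (-1) ^ i * of_nat (n choose i) * pochhammer B i * rGamma (c + of_nat i))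
    = pochhammer (c - B) n * rGamma (c + of_nat n)"
proof (induction n arbitrary: B c)
  case 0
  show ?case by simp
next
  case (Suc n)
  let ?t = "\<lambda>n B c i. (-1) ^ i * of_nat (n choose i) * pochhammer B i * rGamma (c + of_nat i)"
  have "(\<Sum>i=0..Suc n. ?t (Suc n) B c i) = rGamma c + (\<Sum>i=0..n. ?t (Suc n) B c (Suc i))"
    by (subst sum.atLeast0_atMost_Suc_shift) simp
  also have "(\<Sum>i=0..n. ?t (Suc n) B c (Suc i)) = (\<Sum>i=0..n. ?t n B c (Suc i)) - B * (\<Sum>i=0..n. ?t n (B + 1) (c + 1) i)"
    unfolding sum_distrib_left sum_subtractf[symmetric]
    by (intro sum.cong refl) (simp add: pochhammer_rec algebra_simps)
  also have "rGamma c + ((\<Sum>i=0..n. ?t n B c (Suc i)) - B * (\<Sum>i=0..n. ?t n (B + 1) (c + 1) i))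
     = (\<Sum>i=0..Suc n. ?t n B c i) - B * (\<Sum>i=0..n. ?t n (B + 1) (c + 1) i)"
    by (subst sum.atLeast0_atMost_Suc_shift) simp
  also have "(\<Sum>i=0..Suc n. ?t n B c i) = (\<Sum>i=0..n. ?t n B c i)" by simp
  also have "\<dots> = pochhammer (c - B) n * ((c + of_nat n) * rGamma (c + of_nat n + 1))"
    unfolding Suc.IH rGamma_plus1 ..
  also have "(\<Sum>i=0..n. ?t n (B + 1) (c + 1) i) = pochhammer (c - B) n * rGamma (c + of_nat n + 1)"
    unfolding Suc.IH by (simp add: add_ac)
  finally show ?case by (simp add: pochhammer_Suc algebra_simps)
qed

text \<open>
  Legendre's duplication formula for \<open>1 / Gamma\<close>; at the poles of \<open>Gamma b\<close> or \<open>Gamma (b + 1 / 2)\<close> both sides are zero.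
\<close>
lemma rGamma_duplication:
  fixes b :: complex
  shows "sqrt pi * 2 powr (1 - 2 * b) * rGamma b * rGamma (b + 1 / 2) = rGamma (2 * b)"
proof (cases "b \<in> \<int>\<^sub>\<le>\<^sub>0 \<or> b + 1 / 2 \<in> \<int>\<^sub>\<le>\<^sub>0")
  case True
  have "2 * b \<in> \<int>\<^sub>\<le>\<^sub>0"
  proof (cases "b \<in> \<int>\<^sub>\<le>\<^sub>0")
    case True
    then obtain n where "b = of_int n" "n \<le> 0" by (auto elim!: nonpos_Ints_cases)
    then have "2 * b = of_int (2 * n)" "2 * n \<le> 0" by auto
    then show ?thesis by (metis nonpos_Ints_of_int)
  next
    case False
    with True obtain n where "b + 1 / 2 = of_int n" "n \<le> 0" by (auto elim!: nonpos_Ints_cases)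
    then have "2 * b = of_int (2 * n - 1)" "2 * n - 1 \<le> 0" by (auto simp: field_simps)
    then show ?thesis by (metis nonpos_Ints_of_int)
  qed
  then show ?thesis using True by (auto simp: rGamma_nonpos_Int)
next
  case False
  have e: "(2::complex) powr (1 - 2 * b) = exp ((1 - 2 * b) * of_real (ln 2))"
    using Ln_of_real[of 2] by (simp add: powr_def)
  have "rGamma b * rGamma (b + 1 / 2) = inverse (Gamma b * Gamma (b + 1 / 2))"
    by (simp add: rGamma_inverse_Gamma)
  also have "\<dots> = inverse (2 powr (1 - 2 * b) * of_real (sqrt pi) * Gamma (2 * b))"
    using False by (subst Gamma_legendre_duplication) (simp_all add: e)
  finally show ?thesis by (simp add: rGamma_inverse_Gamma field_simps)
qed

text \<open>
  The number of matchings with \<open>k\<close> edges on \<open>n\<close> vertices, divided by \<open>2 ^ k\<close>.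
\<close>
definition matching_coeff :: "nat \<Rightarrow> nat \<Rightarrow> complex"
  where "matching_coeff n k = (if 2 * k \<le> n then fact n / (4 ^ k * fact k * fact (n - 2 * k)) else 0)"

lemma matching_coeff_0 [simp]: "matching_coeff n 0 = 1"
  by (simp add: matching_coeff_def)

text \<open>
  The recurrence for matchings: one vertex is unmatched, or matched with one of the \<open>n + 1\<close> others.
\<close>
lemma matching_coeff_rec:
  "matching_coeff (Suc (Suc n)) (Suc k) = matching_coeff (Suc n) (Suc k) + of_nat (Suc n) / 2 * matching_coeff n k"
proof (cases "2 * k \<le> n")
  case True
  then obtain j where n: "n = 2 * k + j" by (auto simp: le_iff_add)
  have f: "fact (Suc k) = (of_nat (Suc k) * fact k :: complex)" by (simp only: fact_Suc)
  show ?thesis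
  proof (cases j)
    case 0
    have "fact (Suc (Suc n)) = (2 * of_nat (Suc k) * (of_nat (Suc n) * fact n) :: complex)"
      using n 0 by (simp add: algebra_simps)
    moreover have "2 * Suc k \<le> Suc (Suc n)" "\<not> 2 * Suc k \<le> Suc n" "Suc (Suc n) - 2 * Suc k = 0" "n - 2 * k = 0"
      using n 0 by auto
    moreover have "(of_nat (Suc k) :: complex) \<noteq> 0" by (rule of_nat_neq_0)
    ultimately show ?thesis unfolding matching_coeff_def using True f
      by (simp del: of_nat_Suc fact_Suc add: field_simps)
  next
    case (Suc i)
    have "of_nat (Suc (Suc n)) = (of_nat j + 2 * of_nat (Suc k) :: complex)" using n by simp
    moreover have "fact (Suc (Suc n)) = (of_nat (Suc (Suc n)) * fact (Suc n) :: complex)" by (simp only: fact_Suc)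
    moreover have "fact (Suc n) = (of_nat (Suc n) * fact n :: complex)" by (simp only: fact_Suc)
    moreover have "fact j = (of_nat j * fact i :: complex)" using Suc by (simp only: fact_Suc)
    moreover have "(of_nat j :: complex) \<noteq> 0" "(of_nat (Suc k) :: complex) \<noteq> 0"
      using Suc by (simp_all del: of_nat_Suc)
    moreover have "2 * Suc k \<le> Suc (Suc n)" "2 * Suc k \<le> Suc n" "Suc (Suc n) - 2 * Suc k = j" "Suc n - 2 * Suc k = i" "n - 2 * k = j"
      using n Suc by auto
    ultimately show ?thesis unfolding matching_coeff_def using True f
      by (simp del: of_nat_Suc fact_Suc add: field_simps)
  qed
next
  case False
  then show ?thesis by (simp add: matching_coeff_def)
qed

text \<open>
  This is Gauss's sum of \<open>2F1(- n / 2, (1 - n) / 2; b + 1 / 2; 1)\<close> in a form valid for all \<open>b\<close>, and it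
  compares coefficients in the quadratic transformation. By the recurrence for matchings the sum for \<open>n + 2\<close> at
  \<open>b\<close> is a combination of the sum for \<open>n + 1\<close> at \<open>b\<close> and the sum for \<open>n\<close> at \<open>b + 1\<close>.
\<close>
lemma matching_rGamma_sum:
  fixes b :: complex
  shows "sqrt pi * 2 powr (1 - 2 * b) * rGamma b *
      (\<Sum>k=0..n. matching_coeff n k * rGamma (b + 1 / 2 + of_nat k))
    = 2 ^ n * pochhammer b n * rGamma (2 * b + of_nat n)"
proof (induction n arbitrary: b rule: induct_nat_012)
  case 0
  show ?case using rGamma_duplication[of b] by simp
next
  case 1
  have "rGamma (2 * b) = 2 * b * rGamma (2 * b + 1)" by (simp add: rGamma_plus1)
  then show ?case using rGamma_duplication[of b] by (simp add: matching_coeff_def)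
next
  case (ge2 n)
  define U where "U n c = (\<Sum>k=0..n. matching_coeff n k * rGamma (c + of_nat k))" for n and c :: complex
  have "U (Suc (Suc n)) c = rGamma c + (\<Sum>k=0..Suc n. matching_coeff (Suc (Suc n)) (Suc k) * rGamma (c + of_nat (Suc k)))" for c
    unfolding U_def by (subst sum.atLeast0_atMost_Suc_shift) simp
  also have "\<dots> c = rGamma c + (\<Sum>k=0..Suc n. matching_coeff (Suc n) (Suc k) * rGamma (c + of_nat (Suc k)))
      + of_nat (Suc n) / 2 * (\<Sum>k=0..Suc n. matching_coeff n k * rGamma ((c + 1) + of_nat k))" for c
    unfolding sum_distrib_left add.assoc sum.distrib[symmetric] matching_coeff_rec
    by (intro arg_cong2[where f = "(+)"] sum.cong refl) (simp add: algebra_simps)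
  also have "\<dots> c = (\<Sum>k=0..Suc (Suc n). matching_coeff (Suc n) k * rGamma (c + of_nat k))
      + of_nat (Suc n) / 2 * (\<Sum>k=0..Suc n. matching_coeff n k * rGamma ((c + 1) + of_nat k))" for c
    by (subst (2) sum.atLeast0_atMost_Suc_shift) simp
  also have "\<dots> c = U (Suc n) c + of_nat (Suc n) / 2 * U n (c + 1)" for c
    by (simp add: U_def matching_coeff_def)
  finally have rec: "U (Suc (Suc n)) c = U (Suc n) c + of_nat (Suc n) / 2 * U n (c + 1)" for c .
  \<comment> \<open>The prefactor absorbs the shift of \<open>b\<close>: \<open>b D (b + 1)\<close> is proportional to \<open>D b\<close>.\<close>
  define D where "D b = sqrt pi * 2 powr (1 - 2 * b) * rGamma b" for b :: complex
  have D: "D b = 4 * b * D (b + 1)"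
  proof -
    have "(2::complex) powr (1 - 2 * b) = 2 powr (2 + (1 - 2 * (b + 1)))" by (simp add: algebra_simps)
    also have "\<dots> = 4 * 2 powr (1 - 2 * (b + 1))" by (subst powr_add) (simp add: powr_numeral)
    finally show ?thesis unfolding D_def using rGamma_plus1[of b] by (simp add: mult_ac)
  qed
  have IH: "D b * U n (b + 1 / 2) = 2 ^ n * pochhammer b n * rGamma (2 * b + of_nat n)"
      "D b * U (Suc n) (b + 1 / 2) = 2 ^ Suc n * pochhammer b (Suc n) * rGamma (2 * b + of_nat (Suc n))" for b
    using ge2.IH unfolding D_def U_def by blast+
  have "D b * U (Suc (Suc n)) (b + 1 / 2) = D b * U (Suc n) (b + 1 / 2) + of_nat (Suc n) / 2 * (D b * U n ((b + 1) + 1 / 2))"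
    unfolding rec by (simp add: algebra_simps)
  also have "D b * U n ((b + 1) + 1 / 2) = 4 * b * (2 ^ n * pochhammer (b + 1) n * rGamma (2 * (b + 1) + of_nat n))"
    unfolding IH(1)[symmetric] D by simp
  also have "\<dots> = 4 * 2 ^ n * pochhammer b (Suc n) * rGamma (2 * b + of_nat (Suc n) + 1)"
    by (simp add: pochhammer_rec algebra_simps)
  also have "D b * U (Suc n) (b + 1 / 2)
      = 2 ^ Suc n * pochhammer b (Suc n) * ((2 * b + of_nat (Suc n)) * rGamma (2 * b + of_nat (Suc n) + 1))"
    unfolding IH(2) rGamma_plus1 ..
  finally have "D b * U (Suc (Suc n)) (b + 1 / 2) =
      2 ^ Suc (Suc n) * (pochhammer b (Suc n) * (b + of_nat (Suc n))) * rGamma (2 * b + of_nat (Suc n) + 1)"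
    by (simp add: algebra_simps)
  also have "\<dots> = 2 ^ Suc (Suc n) * pochhammer b (Suc (Suc n)) * rGamma (2 * b + of_nat (Suc (Suc n)))"
    unfolding pochhammer_Suc[of b "Suc n"] by (simp add: add_ac)
  finally show ?case by (simp only: D_def U_def)
qed

lemma has_fps_expansion_unique_eventually:
  assumes "f has_fps_expansion F" "g has_fps_expansion F"
  shows "eventually (\<lambda>z. f z = g z) (nhds 0)"
  using assms unfolding has_fps_expansion_def by (auto elim: eventually_elim2)

text \<open>
  The coefficients of the right-hand side are Chu-Vandermonde sums.
\<close>
lemma olver_series_pfaff:
  "eventually (\<lambda>w. olver_series a b c w = (1 - w) powr (-a) * olver_series a (c - b) c (w / (w - 1))) (nhds 0)"
proof -
  define F where "F = olver_fps a (c - b) c"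
  let ?K = "fps_const (-1) * (fps_X * binom_fps 1) ^ 1"
  have "(\<lambda>x. (-1) * (x / (1 - x))) has_fps_expansion ?K"
    unfolding power_one_right by (intro fps_expansion_intros has_fps_expansion_moebius)
  then have 1: "(olver_series a (c - b) c \<circ> (\<lambda>x. (-1) * (x / (1 - x)))) has_fps_expansion fps_compose F ?K"
    unfolding F_def by (rule has_fps_expansion_compose[OF olver_series_has_fps_expansion]) simp
  have "(\<lambda>w. olver_series a (c - b) c ((-1) * (w / (1 - w))) * (1 - w) powr (-a)) has_fps_expansion fps_compose F ?K * binom_fps a"
    using has_fps_expansion_mult[OF 1 has_fps_expansion_one_minus_powr[of a]] by (simp add: o_def)
  also have "fps_compose F ?K * binom_fps a = olver_fps a b c"
  proof (rule fps_ext)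
    fix n
    have "fps_nth (fps_compose F ?K * binom_fps a) n =
       (\<Sum>i=0..n. fps_nth F i * (-1) ^ i * (pochhammer (a + of_nat i) (n - i) / fact (n - i)))"
      by (subst fps_compose_moebius_binom_nth) auto
    also have "\<dots> = (\<Sum>i=0..n. pochhammer a n / fact n *
        ((-1) ^ i * of_nat (n choose i) * pochhammer (c - b) i * rGamma (c + of_nat i)))"
    proof (intro sum.cong refl)
      fix i assume "i \<in> {0..n}"
      then have i: "i \<le> n" by simp
      show "fps_nth F i * (-1) ^ i * (pochhammer (a + of_nat i) (n - i) / fact (n - i)) = pochhammer a n / fact n *
        ((-1) ^ i * of_nat (n choose i) * pochhammer (c - b) i * rGamma (c + of_nat i))"
        unfolding F_def olver_fps_nth pochhammer_product[OF i, of a] binomial_fact[OF i] by simp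
    qed
    also have "\<dots> = fps_nth (olver_fps a b c) n"
      unfolding sum_distrib_left[symmetric] chu_vandermonde_rGamma olver_fps_nth by simp
    finally show "fps_nth (fps_compose F ?K * binom_fps a) n = fps_nth (olver_fps a b c) n" .
  qed
  finally have "eventually (\<lambda>w. olver_series a (c - b) c ((-1) * (w / (1 - w))) * (1 - w) powr (-a) = olver_series a b c w) (nhds 0)"
    by (rule has_fps_expansion_unique_eventually[OF _ olver_series_has_fps_expansion])
  then show ?thesis
  proof eventually_elim
    case (elim w)
    have "(-1) * (w / (1 - w)) = w / (w - 1)" by (metis minus_diff_eq minus_divide_right mult_minus1)
    then show ?case using elim by (simp add: mult.commute)
  qed
qed

text \<open>
  In the variable \<open>x = w / 2\<close> the inner function is \<open>(x / (1 - x))\<^sup>2\<close>. The Pochhammer symbols of \<open>a / 2\<close> and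
  \<open>(a + 1) / 2\<close> combine to the one of \<open>a\<close>, after which only \<open>matching_rGamma_sum\<close> is left.
\<close>
lemma olver_series_quadratic:
  fixes a b :: complex
  shows "eventually (\<lambda>w. olver_series a b (2 * b) w = sqrt pi * 2 powr (1 - 2 * b) * rGamma b *
     (1 - w / 2) powr (-a) * olver_series (a / 2) ((a + 1) / 2) (b + 1 / 2) ((w / (2 - w))\<^sup>2)) (nhds 0)"
proof -
  define F where "F = olver_fps (a / 2) ((a + 1) / 2) (b + 1 / 2)"
  define k where "k = sqrt pi * 2 powr (1 - 2 * b) * rGamma b"
  let ?K = "fps_const 1 * (fps_X * binom_fps 1) ^ 2"
  have "(\<lambda>x. 1 * ((x / (1 - x)) * (x / (1 - x)))) has_fps_expansion ?K"
    unfolding power2_eq_square by (intro fps_expansion_intros has_fps_expansion_moebius)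
  then have 1: "(olver_series (a / 2) ((a + 1) / 2) (b + 1 / 2) \<circ> (\<lambda>x. 1 * ((x / (1 - x)) * (x / (1 - x))))) has_fps_expansion fps_compose F ?K"
    unfolding F_def by (rule has_fps_expansion_compose[OF olver_series_has_fps_expansion]) (simp add: power2_eq_square)
  have "(\<lambda>x. k * (olver_series (a / 2) ((a + 1) / 2) (b + 1 / 2) ((x / (1 - x))\<^sup>2) * (1 - x) powr (-a)))
    has_fps_expansion fps_const k * (fps_compose F ?K * binom_fps a)"
    using has_fps_expansion_cmult_left[OF has_fps_expansion_mult[OF 1 has_fps_expansion_one_minus_powr[of a]], of k]
    by (simp add: o_def power2_eq_square)
  also have "fps_const k * (fps_compose F ?K * binom_fps a) = fps_compose (olver_fps a b (2 * b)) (fps_const 2 * fps_X)"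
  proof (rule fps_ext)
    fix n
    have "fps_nth (fps_compose F ?K * binom_fps a) n =
       (\<Sum>i=0..n. fps_nth F i * 1 ^ i * (if 2 * i \<le> n then pochhammer (a + of_nat (2 * i)) (n - 2 * i) / fact (n - 2 * i) else 0))"
      by (subst fps_compose_moebius_binom_nth) auto
    also have "\<dots> = (\<Sum>i=0..n. pochhammer a n / fact n * (matching_coeff n i * rGamma (b + 1 / 2 + of_nat i)))"
    proof (intro sum.cong refl)
      fix i assume "i \<in> {0..n}"
      have "pochhammer a (2 * i) = 4 ^ i * pochhammer (a / 2) i * pochhammer ((a + 1) / 2) i"
        using pochhammer_double[of "a / 2" i] by (simp add: power_mult add_divide_distrib)
      then show "fps_nth F i * 1 ^ i * (if 2 * i \<le> n then pochhammer (a + of_nat (2 * i)) (n - 2 * i) / fact (n - 2 * i) else 0)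
         = pochhammer a n / fact n * (matching_coeff n i * rGamma (b + 1 / 2 + of_nat i))"
        using pochhammer_product[of "2 * i" n a]
        by (simp add: F_def olver_fps_nth matching_coeff_def mult_ac del: of_nat_mult)
    qed
    finally have "fps_nth (fps_const k * (fps_compose F ?K * binom_fps a)) n
      = pochhammer a n / fact n * (k * (\<Sum>i=0..n. matching_coeff n i * rGamma (b + 1 / 2 + of_nat i)))"
      by (simp add: sum_distrib_left mult_ac)
    also have "\<dots> = pochhammer a n / fact n * (2 ^ n * pochhammer b n * rGamma (2 * b + of_nat n))"
      unfolding k_def matching_rGamma_sum ..
    also have "\<dots> = fps_nth (fps_compose (olver_fps a b (2 * b)) (fps_const 2 * fps_X)) n"
      by (simp add: fps_compose_linear olver_fps_nth)
    finally show "fps_nth (fps_const k * (fps_compose F ?K * binom_fps a)) n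
      = fps_nth (fps_compose (olver_fps a b (2 * b)) (fps_const 2 * fps_X)) n" .
  qed
  finally have 2: "(\<lambda>x. k * (olver_series (a / 2) ((a + 1) / 2) (b + 1 / 2) ((x / (1 - x))\<^sup>2) * (1 - x) powr (-a)))
    has_fps_expansion fps_compose (olver_fps a b (2 * b)) (fps_const 2 * fps_X)" .
  have "(\<lambda>x::complex. 2 * x) has_fps_expansion fps_const 2 * fps_X"
    by (intro fps_expansion_intros)
  then have "(olver_series a b (2 * b) \<circ> (\<lambda>x. 2 * x)) has_fps_expansion fps_compose (olver_fps a b (2 * b)) (fps_const 2 * fps_X)"
    by (intro has_fps_expansion_compose olver_series_has_fps_expansion) auto
  from has_fps_expansion_unique_eventually[OF this 2]
  have ev: "eventually (\<lambda>x. olver_series a b (2 * b) (2 * x) =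
      k * (olver_series (a / 2) ((a + 1) / 2) (b + 1 / 2) ((x / (1 - x))\<^sup>2) * (1 - x) powr (-a))) (nhds 0)"
    by (simp add: o_def)
  have "filterlim (\<lambda>w::complex. w / 2) (nhds 0) (nhds 0)"
    by (auto intro!: tendsto_eq_intros filterlim_ident)
  from eventually_compose_filterlim[OF ev this] show ?thesis
  proof eventually_elim
    case (elim w)
    have "w / 2 / (1 - w / 2) = w / (2 - w)" by (cases "w = 2") (auto simp: divide_simps)
    then show ?case using elim by (simp add: k_def mult_ac)
  qed
qed

section \<open>The hypergeometric function on the slit plane\<close>

text \<open>
  The complex plane cut along the part of the real axis outside \<open>I\<close>. For an interval \<open>I\<close> it is
  starlike with respect to each point of \<open>I\<close>.
\<close>
definition slit :: "real set \<Rightarrow> complex set"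
  where "slit I = {z. Im z \<noteq> 0 \<or> Re z \<in> I}"

lemma slit_eq_Compl: "slit I = - complex_of_real ` (- I)"
  by (auto simp: slit_def complex_eq_iff image_iff)

lemma cut_domain_eq_slit: "cut_domain = slit {-1<..<1}"
  by (auto simp: slit_eq_Compl cut_domain_def)

lemma open_slit: "open I \<Longrightarrow> open (slit I)"
proof -
  assume "open I"
  then have "open (Re -` I)" by (intro open_vimage continuous_on_Re continuous_on_id)
  moreover have "open {z. Im z \<noteq> 0}" by (intro open_Collect_neq continuous_intros)
  moreover have "slit I = {z. Im z \<noteq> 0} \<union> Re -` I" by (auto simp: slit_def)
  ultimately show ?thesis by auto
qed

lemma slit_segment:
  assumes "convex I" "s \<in> I" "z \<in> slit I"
  shows "closed_segment (of_real s) z \<subseteq> slit I"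
proof
  fix y assume "y \<in> closed_segment (of_real s) z"
  then obtain u where u: "0 \<le> u" "u \<le> 1" "y = (1 - u) *\<^sub>R of_real s + u *\<^sub>R z"
    by (auto simp: closed_segment_def)
  then have y: "Re y = (1 - u) *\<^sub>R s + u *\<^sub>R Re z" "Im y = u * Im z" by auto
  show "y \<in> slit I"
  proof (cases "u = 0 \<or> Im z = 0")
    case True
    then have "Re z \<in> I \<or> u = 0" using assms(3) by (auto simp: slit_def)
    then have "Re y \<in> I" using y u assms(2) convexD_alt[OF assms(1,2), of "Re z" u] by auto
    then show ?thesis by (simp add: slit_def)
  qed (auto simp: slit_def y)
qed

lemma of_real_in_slit: "s \<in> I \<Longrightarrow> of_real s \<in> slit I"
  by (simp add: slit_def)

lemma connected_Int_slit:
  assumes "convex I" "s \<in> I" "convex T" "of_real s \<in> T"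
  shows "connected (T \<inter> slit I)"
proof -
  have "starlike (T \<inter> slit I)"
    unfolding starlike_def
  proof (rule bexI[of _ "of_real s"], intro ballI)
    fix z assume "z \<in> T \<inter> slit I"
    then show "closed_segment (of_real s) z \<subseteq> T \<inter> slit I"
      using slit_segment[OF assms(1,2)] closed_segment_subset[OF assms(4) _ assms(3)] by blast
  qed (use assms of_real_in_slit in auto)
  then show ?thesis by (rule starlike_imp_connected)
qed

lemma connected_slit:
  assumes "convex I" "s \<in> I"
  shows "connected (slit I)"
  using connected_Int_slit[OF assms, of UNIV] by simp

lemma slit_identity:
  assumes I: "open I" "convex I" "0 \<in> I" and T: "open T" "convex T" "0 \<in> T"
    and hol: "f holomorphic_on (T \<inter> slit I)" "g holomorphic_on (T \<inter> slit I)"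
    and ev: "eventually (\<lambda>z. f z = g z) (nhds 0)"
    and z: "z \<in> T \<inter> slit I"
  shows "f z = g z"
proof -
  obtain U where U: "open U" "0 \<in> U" "\<And>z. z \<in> U \<Longrightarrow> f z = g z"
    using ev by (auto simp: eventually_nhds)
  show ?thesis
  proof (rule analytic_continuation_open[of "U \<inter> (T \<inter> slit I)" "T \<inter> slit I" f g])
    show "open (U \<inter> (T \<inter> slit I))" "open (T \<inter> slit I)" using U T I open_slit by auto
    show "U \<inter> (T \<inter> slit I) \<noteq> {}" using U T I of_real_in_slit[of 0 I] by auto
    show "connected (T \<inter> slit I)" using connected_Int_slit[of I 0 T] I T by simp
  qed (use hol z U in auto)
qed

lemma hypergeometric_ode_continuation:
  assumes I: "open I" "convex I" "s \<in> I" "0 \<notin> I" "1 \<notin> I"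
    and T: "open T" "connected T" "T \<subseteq> slit I"
    and y: "\<And>z. z \<in> T \<Longrightarrow> (y has_field_derivative y' z) (at z)"
      "\<And>z. z \<in> T \<Longrightarrow> (y' has_field_derivative y'' z) (at z)"
      "\<And>z. z \<in> T \<Longrightarrow> z * (1 - z) * y'' z = ((a + b + 1) * z - c) * y' z + a * b * y z"
  shows "\<exists>Y. Y holomorphic_on slit I \<and> (\<forall>z\<in>T. Y z = y z)"
proof -
  have nz: "z \<noteq> 0" "1 - z \<noteq> 0" if "z \<in> slit I" for z
    using that I(4,5) by (auto simp: slit_def)
  define p where "p z = ((a + b + 1) * z - c) / (z * (1 - z))" for z
  define q where "q z = a * b / (z * (1 - z))" for z
  show ?thesis
  proof (rule linear_ode2_continuation[where p = p and q = q])
    show "open (slit I)" "of_real s \<in> slit I" using I open_slit of_real_in_slit by auto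
    show "closed_segment (of_real s) z \<subseteq> slit I" if "z \<in> slit I" for z
      using slit_segment I that by blast
    show "p holomorphic_on slit I" "q holomorphic_on slit I"
      unfolding p_def q_def using nz by (auto intro!: holomorphic_intros)
    show "(y' has_field_derivative (p z * y' z + q z * y z)) (at z)" if "z \<in> T" for z
    proof -
      have z: "z \<noteq> 0" "1 - z \<noteq> 0" using nz that T(3) by auto
      have "y'' z = (z * (1 - z) * y'' z) / (z * (1 - z))" using z by simp
      also have "\<dots> = p z * y' z + q z * y z"
        unfolding y(3)[OF that] p_def q_def by (simp add: add_divide_distrib)
      finally show ?thesis using y(2)[OF that] by simp
    qed
  qed (use T y in auto)
qed

text \<open>
  The continuation is a choice, so nothing is known of it until some continuation has been exhibited.
\<close>
lemma analytic_continuation_spec: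
  assumes "g holomorphic_on S" "\<And>z. z \<in> A \<Longrightarrow> g z = f z"
  shows "analytic_continuation A S f holomorphic_on S"
    and "\<And>z. z \<in> A \<Longrightarrow> analytic_continuation A S f z = f z"
proof -
  have "\<exists>g. g holomorphic_on S \<and> (\<forall>z\<in>A. g z = f z)" using assms by blast
  from someI_ex[OF this]
  show "analytic_continuation A S f holomorphic_on S"
    and "\<And>z. z \<in> A \<Longrightarrow> analytic_continuation A S f z = f z"
    by (auto simp: analytic_continuation_def)
qed

lemma ball_subset_slit: "ball 0 1 \<subseteq> slit {-1<..<1}"
proof
  fix z :: complex assume "z \<in> ball 0 1"
  then have "\<bar>Re z\<bar> < 1" using abs_Re_le_cmod[of z] by simp
  then show "z \<in> slit {-1<..<1}" by (auto simp: slit_def)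
qed

lemma moebius_in_ball:
  assumes "Re z < 1 / 2"
  shows "z / (z - 1) \<in> ball 0 (1::real)"
proof -
  have "(norm z)\<^sup>2 < (norm (z - 1))\<^sup>2"
    using assms unfolding cmod_power2 by (simp add: power2_eq_square algebra_simps)
  then have "norm z < norm (z - 1)" by (rule power_less_imp_less_base) simp
  moreover have "norm (z - 1) > 0" using calculation norm_ge_zero[of z] by linarith
  ultimately show ?thesis by (simp add: norm_divide divide_simps)
qed

text \<open>
  Two continuations are glued to the series. The differential equation gives one on the plane without \<open>(-\<infinity>, 0]\<close> and
  \<open>[1, \<infinity>)\<close>, with \<open>0\<close> excluded as a singularity of the equation; the unit disc fills in \<open>(-1, 0]\<close>.
  The right-hand side of the Pfaff transformation gives one on the half-plane \<open>Re z < 1 / 2\<close>,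
  where \<open>z / (z - 1)\<close> lies in the unit disc, and this covers \<open>(-\<infinity>, -1]\<close>.
\<close>
lemma olver_series_continuation:
  "\<exists>g. g holomorphic_on slit {..<1} \<and> (\<forall>z\<in>ball 0 1. g z = olver_series a b c z)"
proof -
  let ?f = "olver_series a b c"
  let ?D = "ball 0 1 :: complex set"
  let ?H = "{z. Re z < 1 / 2}"
  obtain y' y'' where y: "\<forall>z\<in>?D. (?f has_field_derivative y' z) (at z) \<and>
     (y' has_field_derivative y'' z) (at z) \<and>
     z * (1 - z) * y'' z = ((a + b + 1) * z - c) * y' z + a * b * ?f z"
    using olver_series_ode[of a b c] by blast
  have "\<exists>G. G holomorphic_on slit {0<..<1} \<and> (\<forall>z\<in>?D \<inter> slit {0<..<1}. G z = ?f z)"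
  proof (rule hypergeometric_ode_continuation[where s = "1 / 2"])
    show "connected (?D \<inter> slit {0<..<1})"
      by (rule connected_Int_slit[where s = "1 / 2"]) (auto simp: norm_divide)
  qed (use y open_slit in auto)
  then obtain G where G: "G holomorphic_on slit {0<..<1}" "\<And>z. z \<in> ?D \<inter> slit {0<..<1} \<Longrightarrow> G z = ?f z"
    by blast
  define G1 where "G1 z = (if z \<in> ?D then ?f z else G z)" for z
  have "G1 holomorphic_on (?D \<union> slit {0<..<1})"
    unfolding G1_def using G by (intro holomorphic_on_If_Un olver_series_holomorphic open_slit) auto
  moreover have "?D \<union> slit {0<..<1} = slit {-1<..<1}"
  proof
    show "?D \<union> slit {0<..<1} \<subseteq> slit {-1<..<1}" using ball_subset_slit by (auto simp: slit_def)
    show "slit {-1<..<1} \<subseteq> ?D \<union> slit {0<..<1}"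
    proof
      fix z assume "z \<in> slit {-1<..<1}"
      then have "norm z < 1 \<or> Im z \<noteq> 0" by (auto simp: slit_def cmod_def abs_square_less_1)
      then show "z \<in> ?D \<union> slit {0<..<1}" by (auto simp: slit_def)
    qed
  qed
  ultimately have G1: "G1 holomorphic_on slit {-1<..<1}" by simp
  define G2 where "G2 z = (1 - z) powr (-a) * olver_series a (c - b) c (z / (z - 1))" for z
  have oH: "open ?H" "convex ?H" by (rule open_halfspace_Re_lt convex_halfspace_Re_lt)+
  have G2: "G2 holomorphic_on ?H"
  proof -
    have "(olver_series a (c - b) c \<circ> (\<lambda>z. z / (z - 1))) holomorphic_on ?H"
    proof (rule holomorphic_on_compose_gen[OF _ olver_series_holomorphic])
      show "(\<lambda>z. z / (z - 1)) holomorphic_on ?H" by (intro holomorphic_intros) auto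
    qed (use moebius_in_ball in auto)
    then show ?thesis unfolding G2_def o_def
      by (intro holomorphic_intros) (auto simp: complex_nonpos_Reals_iff)
  qed
  have near: "eventually (\<lambda>z. G2 z = G1 z) (nhds 0)"
  proof -
    have "eventually (\<lambda>z. z \<in> ?D) (nhds 0)" by (intro eventually_nhds_in_open) auto
    then show ?thesis using olver_series_pfaff[of a b c]
      by eventually_elim (simp add: G1_def G2_def)
  qed
  have eq: "G2 z = G1 z" if "z \<in> ?H \<inter> slit {-1<..<1}" for z
    using near that oH holomorphic_on_subset[OF G1] holomorphic_on_subset[OF G2]
    by (intro slit_identity[of "{-1<..<1}" ?H G2 G1]) auto
  define h where "h z = (if z \<in> ?H then G2 z else G1 z)" for z
  have "h holomorphic_on (?H \<union> slit {-1<..<1})"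
    unfolding h_def using eq by (intro holomorphic_on_If_Un G2 G1 oH open_slit) auto
  moreover have "slit {..<1} \<subseteq> ?H \<union> slit {-1<..<1}" by (auto simp: slit_def)
  moreover have "h z = ?f z" if "z \<in> ?D" for z
    using eq[of z] that ball_subset_slit by (auto simp: h_def G1_def)
  ultimately show ?thesis using holomorphic_on_subset by blast
qed

lemma olver_2F1_holomorphic: "olver_2F1 a b c holomorphic_on slit {..<1}"
  and olver_2F1_eq_series: "z \<in> ball 0 1 \<Longrightarrow> olver_2F1 a b c z = olver_series a b c z"
proof -
  obtain g where g: "g holomorphic_on slit {..<1}" "\<And>z. z \<in> ball 0 1 \<Longrightarrow> g z = olver_series a b c z"
    using olver_series_continuation[of a b c] by blast
  have e: "- complex_of_real ` {1..} = slit {..<1}" by (auto simp: slit_eq_Compl)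
  show "olver_2F1 a b c holomorphic_on slit {..<1}"
    and "z \<in> ball 0 1 \<Longrightarrow> olver_2F1 a b c z = olver_series a b c z"
    unfolding olver_2F1_def e by (rule analytic_continuation_spec[OF g]; assumption)+
qed

lemma olver_2F1_near_0: "filterlim f (nhds 0) (nhds (0::complex)) \<Longrightarrow>
    eventually (\<lambda>w. olver_2F1 a b c (f w) = olver_series a b c (f w)) (nhds 0)"
  by (rule eventually_compose_filterlim[where F = "nhds 0"],
      rule eventually_mono[OF eventually_nhds_in_open[of "ball 0 1"]])
     (auto intro!: olver_2F1_eq_series)

lemma slit_memI: 
  assumes "\<And>r. r \<ge> 1 \<Longrightarrow> z \<noteq> of_real r"
  shows "z \<in> slit {..<1}"
  using assms by (auto simp: slit_eq_Compl not_less)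

lemma slit_memD: "z \<in> slit {..<1} \<Longrightarrow> r \<ge> 1 \<Longrightarrow> z \<noteq> of_real r"
  by (auto simp: slit_def)

lemma moebius_in_slit:
  assumes w: "w \<in> slit {..<1}"
  shows "w / (w - 1) \<in> slit {..<1}"
proof (rule slit_memI, rule notI)
  fix r :: real assume r: "r \<ge> 1" "w / (w - 1) = of_real r"
  have "w \<noteq> 1" using slit_memD[OF w, of 1] by simp
  then have "w * (of_real r - 1) = of_real r" using r(2) by (simp add: field_simps)
  moreover from this have "r \<noteq> 1" by auto
  ultimately have "w = of_real (r / (r - 1))" by (simp add: field_simps)
  then show False using slit_memD[OF w, of "r / (r - 1)"] r(1) \<open>r \<noteq> 1\<close> by simp
qed

text \<open>
  If \<open>(w / (2 - w))\<^sup>2 = s\<^sup>2\<close> with \<open>s \<ge> 1\<close>, then \<open>w = 2 s / (s + 1)\<close> or \<open>w = 2 s / (s - 1)\<close>, both real and at least \<open>1\<close>.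
  Hence the quadratic transformation holds on the whole slit plane.
\<close>
lemma quadratic_in_slit:
  assumes w: "w \<in> slit {..<1}"
  shows "(w / (2 - w))\<^sup>2 \<in> slit {..<1}"
proof (rule slit_memI, rule notI)
  fix r :: real assume r: "r \<ge> 1" "(w / (2 - w))\<^sup>2 = of_real r"
  define s where "s = sqrt r"
  have s: "s \<ge> 1" "s\<^sup>2 = r" using r(1) by (auto simp: s_def)
  have w2: "w \<noteq> 2" using slit_memD[OF w, of 2] by simp
  have "(w / (2 - w))\<^sup>2 = (of_real s)\<^sup>2" using r(2) s(2) by (metis of_real_power)
  then consider "w / (2 - w) = of_real s" | "w / (2 - w) = - of_real s" by (auto simp: power2_eq_iff)
  then show False
  proof cases
    case 1
    then have "w * of_real (1 + s) = of_real (2 * s)" using w2 by (simp add: field_simps)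
    moreover have "complex_of_real (1 + s) \<noteq> 0" using s(1) by (simp del: of_real_add)
    ultimately have "w = of_real (2 * s / (1 + s))" by (simp add: field_simps)
    then show False using slit_memD[OF w, of "2 * s / (1 + s)"] s(1) by simp
  next
    case 2
    then have e: "w * of_real (s - 1) = of_real (2 * s)" using w2 by (simp add: field_simps)
    then have "s \<noteq> 1" by auto
    with e have "w = of_real (2 * s / (s - 1))" by (simp add: field_simps)
    then show False using slit_memD[OF w, of "2 * s / (s - 1)"] s(1) \<open>s \<noteq> 1\<close> by simp
  qed
qed

lemma slit_identity_0:
  assumes "f holomorphic_on slit {..<1}" "g holomorphic_on slit {..<1}"
    and "eventually (\<lambda>z. f z = g z) (nhds 0)" "z \<in> slit {..<1}"
  shows "f z = g z"
  using slit_identity[of "{..<1}" UNIV f g z] assms by simp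

lemma olver_2F1_pfaff:
  assumes w: "w \<in> slit {..<1}"
  shows "olver_2F1 a b c w = (1 - w) powr (-a) * olver_2F1 a (c - b) c (w / (w - 1))"
proof (rule slit_identity_0[where f = "olver_2F1 a b c"
      and g = "\<lambda>w. (1 - w) powr (-a) * olver_2F1 a (c - b) c (w / (w - 1))", OF olver_2F1_holomorphic _ _ w])
  have "(olver_2F1 a (c - b) c \<circ> (\<lambda>w. w / (w - 1))) holomorphic_on slit {..<1}"
  proof (rule holomorphic_on_compose_gen[OF _ olver_2F1_holomorphic])
    show "(\<lambda>w. w / (w - 1)) holomorphic_on slit {..<1}"
      by (intro holomorphic_intros) (auto simp: slit_def)
  qed (use moebius_in_slit in blast)
  then show "(\<lambda>w. (1 - w) powr (-a) * olver_2F1 a (c - b) c (w / (w - 1))) holomorphic_on slit {..<1}"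
    unfolding o_def by (intro holomorphic_intros) (auto simp: complex_nonpos_Reals_iff slit_def)
  have "filterlim (\<lambda>w::complex. w / (w - 1)) (nhds 0) (nhds 0)"
    by (auto intro!: tendsto_eq_intros filterlim_ident)
  from olver_2F1_near_0[OF this, of a "c - b" c] olver_2F1_near_0[OF filterlim_ident, of a b c] olver_series_pfaff[of a b c]
  show "eventually (\<lambda>w. olver_2F1 a b c w = (1 - w) powr (-a) * olver_2F1 a (c - b) c (w / (w - 1))) (nhds 0)"
    by eventually_elim simp
qed

lemma olver_2F1_quadratic:
  fixes a b w :: complex
  assumes w: "w \<in> slit {..<1}"
  shows "olver_2F1 a b (2 * b) w = sqrt pi * 2 powr (1 - 2 * b) * rGamma b *
     (1 - w / 2) powr (-a) * olver_2F1 (a / 2) ((a + 1) / 2) (b + 1 / 2) ((w / (2 - w))\<^sup>2)"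
proof (rule slit_identity_0[where f = "olver_2F1 a b (2 * b)"
      and g = "\<lambda>w. sqrt pi * 2 powr (1 - 2 * b) * rGamma b *
     (1 - w / 2) powr (-a) * olver_2F1 (a / 2) ((a + 1) / 2) (b + 1 / 2) ((w / (2 - w))\<^sup>2)", OF olver_2F1_holomorphic _ _ w])
  let ?F = "olver_2F1 (a / 2) ((a + 1) / 2) (b + 1 / 2)"
  have "(?F \<circ> (\<lambda>w. (w / (2 - w))\<^sup>2)) holomorphic_on slit {..<1}"
  proof (rule holomorphic_on_compose_gen[OF _ olver_2F1_holomorphic])
    show "(\<lambda>w. (w / (2 - w))\<^sup>2) holomorphic_on slit {..<1}"
      by (intro holomorphic_intros) (auto simp: slit_def)
  qed (use quadratic_in_slit in blast)
  then show "(\<lambda>w. sqrt pi * 2 powr (1 - 2 * b) * rGamma b *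
     (1 - w / 2) powr (-a) * ?F ((w / (2 - w))\<^sup>2)) holomorphic_on slit {..<1}"
    unfolding o_def by (intro holomorphic_intros) (auto simp: complex_nonpos_Reals_iff slit_def)
  have "filterlim (\<lambda>w::complex. (w / (2 - w))\<^sup>2) (nhds 0) (nhds 0)"
    by (auto intro!: tendsto_eq_intros filterlim_ident)
  from olver_2F1_near_0[OF this, of "a / 2" "(a + 1) / 2" "b + 1 / 2"] olver_2F1_near_0[OF filterlim_ident, of a b "2 * b"] olver_series_quadratic[of a b]
  show "eventually (\<lambda>w. olver_2F1 a b (2 * b) w = sqrt pi * 2 powr (1 - 2 * b) * rGamma b *
     (1 - w / 2) powr (-a) * ?F ((w / (2 - w))\<^sup>2)) (nhds 0)"
    by eventually_elim simp
qed

lemma olver_2F1_ode: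
  "\<exists>y' y''. \<forall>z\<in>slit {..<1}. (olver_2F1 a b c has_field_derivative y' z) (at z) \<and>
     (y' has_field_derivative y'' z) (at z) \<and>
     z * (1 - z) * y'' z = ((a + b + 1) * z - c) * y' z + a * b * olver_2F1 a b c z"
proof (intro exI ballI conjI)
  let ?F = "olver_2F1 a b c" and ?S = "slit {..<1}" and ?D = "ball 0 1 :: complex set"
  have oS: "open ?S" by (intro open_slit) auto
  have h1: "deriv ?F holomorphic_on ?S" by (intro holomorphic_deriv olver_2F1_holomorphic oS)
  have h2: "deriv (deriv ?F) holomorphic_on ?S" by (intro holomorphic_deriv h1 oS)
  obtain y' y'' where y: "\<forall>z\<in>?D. (olver_series a b c has_field_derivative y' z) (at z) \<and>
     (y' has_field_derivative y'' z) (at z) \<and>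
     z * (1 - z) * y'' z = ((a + b + 1) * z - c) * y' z + a * b * olver_series a b c z"
    using olver_series_ode[of a b c] by blast
  have d1: "deriv ?F z = y' z" if "z \<in> ?D" for z
  proof (rule DERIV_imp_deriv)
    show "(?F has_field_derivative y' z) (at z)"
      by (rule has_field_derivative_transform_within_open[of "olver_series a b c" _ z ?D])
         (use y that in \<open>auto simp: olver_2F1_eq_series\<close>)
  qed
  have d2: "deriv (deriv ?F) z = y'' z" if "z \<in> ?D" for z
  proof (rule DERIV_imp_deriv)
    show "(deriv ?F has_field_derivative y'' z) (at z)"
      by (rule has_field_derivative_transform_within_open[of y' _ z ?D]) (use y that in \<open>auto simp: d1\<close>)
  qed
  fix z assume z: "z \<in> ?S"
  show "(?F has_field_derivative deriv ?F z) (at z)" "(deriv ?F has_field_derivative deriv (deriv ?F) z) (at z)"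
    using olver_2F1_holomorphic h1 oS z by (auto intro: holomorphic_derivI)
  show "z * (1 - z) * deriv (deriv ?F) z = ((a + b + 1) * z - c) * deriv ?F z + a * b * ?F z"
  proof (rule slit_identity_0[where f = "\<lambda>z. z * (1 - z) * deriv (deriv ?F) z"
        and g = "\<lambda>z. ((a + b + 1) * z - c) * deriv ?F z + a * b * ?F z", OF _ _ _ z])
    show "(\<lambda>z. z * (1 - z) * deriv (deriv ?F) z) holomorphic_on ?S"
      "(\<lambda>z. ((a + b + 1) * z - c) * deriv ?F z + a * b * ?F z) holomorphic_on ?S"
      using h1 h2 olver_2F1_holomorphic by (auto intro!: holomorphic_intros)
    have "eventually (\<lambda>z. z \<in> ?D) (nhds 0)" by (intro eventually_nhds_in_open) auto
    then show "eventually (\<lambda>z. z * (1 - z) * deriv (deriv ?F) z = ((a + b + 1) * z - c) * deriv ?F z + a * b * ?F z) (nhds 0)"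
      by eventually_elim (use y in \<open>simp add: d1 d2 olver_2F1_eq_series\<close>)
  qed
qed

text \<open>
  The continuation across the branch cut \<open>(1, \<infinity>)\<close> from one side. It is in general different for
  the two half-planes.
\<close>
lemma olver_2F1_halfplane_continuation:
  assumes T: "open T" "convex T" "\<And>z. z \<in> T \<Longrightarrow> Im z \<noteq> 0"
  shows "\<exists>Y. Y holomorphic_on slit {1<..} \<and> (\<forall>z\<in>T. Y z = olver_2F1 a b c z)"
proof -
  have sub: "T \<subseteq> slit I" for I using T(3) by (auto simp: slit_def)
  obtain y' y'' where y: "\<forall>z\<in>slit {..<1}. (olver_2F1 a b c has_field_derivative y' z) (at z) \<and>
     (y' has_field_derivative y'' z) (at z) \<and>
     z * (1 - z) * y'' z = ((a + b + 1) * z - c) * y' z + a * b * olver_2F1 a b c z"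
    using olver_2F1_ode[of a b c] by blast
  show ?thesis
    by (rule hypergeometric_ode_continuation[where s = 2])
       (use T sub[of "{..<1}"] sub[of "{1<..}"] y in \<open>auto simp: convex_connected\<close>)
qed

section \<open>Jacobi and Legendre functions off and on the cut\<close>

text \<open>
  Here and below the sign \<open>\<sigma>\<close> selects the upper (\<open>\<sigma> = 1\<close>) or the lower (\<open>\<sigma> = -1\<close>) half-plane.
\<close>
lemma Ln_uminus_halfplane:
  assumes "\<sigma> = 1 \<or> \<sigma> = -1" "\<sigma> * Im z > 0"
  shows "Ln (- z) = Ln z - \<sigma> * (\<i> * pi)"
proof -
  have "z \<noteq> 0" using assms by auto
  then show ?thesis using assms by (auto simp: Ln_minus)
qed

lemma Im_Ln_neg:
  assumes "Im z < 0"
  shows "- pi < Im (Ln z)" "Im (Ln z) < 0"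
proof -
  have "z \<noteq> 0" using assms by auto
  then show "- pi < Im (Ln z)" "Im (Ln z) < 0"
    using Im_Ln_pos_le[of z] mpi_less_Im_Ln[of z] Im_Ln_le_pi[of z] assms by auto
qed

text \<open>
  The arguments of two points of the same open half-plane differ by less than \<open>\<pi>\<close>.
\<close>
lemma Ln_divide_halfplane:
  assumes "\<sigma> * Im u > 0" "\<sigma> * Im v > 0"
  shows "Ln (u / v) = Ln u - Ln v"
proof (rule Ln_unique)
  have "u \<noteq> 0" "v \<noteq> 0" using assms by auto
  then show "exp (Ln u - Ln v) = u / v" by (simp add: exp_diff)
  have "Im u > 0 \<and> Im v > 0 \<or> Im u < 0 \<and> Im v < 0"
    using assms by (auto simp: zero_less_mult_iff)
  then have "\<bar>Im (Ln u - Ln v)\<bar> < pi"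
    using Im_Ln_pos_lt_imp[of u] Im_Ln_pos_lt_imp[of v] Im_Ln_neg[of u] Im_Ln_neg[of v] by auto
  then show "- pi < Im (Ln u - Ln v)" "Im (Ln u - Ln v) \<le> pi" by auto
qed

lemma powr_divide_halfplane:
  assumes "\<sigma> * Im u > 0" "\<sigma> * Im v > 0"
  shows "(u / v) powr s = u powr s / v powr s"
proof -
  have "u \<noteq> 0" "v \<noteq> 0" using assms by auto
  then show ?thesis
    by (simp add: powr_def Ln_divide_halfplane[OF assms] right_diff_distrib exp_diff)
qed

lemma powr_minus_one_halfplane:
  assumes "\<sigma> = 1 \<or> \<sigma> = -1" "\<sigma> * Im z > 0"
  shows "(z - 1) powr s = exp (\<sigma> * (\<i> * pi * s)) * (1 - z) powr s"
proof -
  have nz: "z \<noteq> 1" using assms by auto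
  have "- \<sigma> = 1 \<or> - \<sigma> = -1" "(- \<sigma>) * Im (1 - z) > 0" using assms by auto
  from Ln_uminus_halfplane[OF this] have "Ln (z - 1) = Ln (1 - z) + \<sigma> * (\<i> * pi)" by simp
  then show ?thesis using nz by (simp add: powr_def exp_add[symmetric] algebra_simps)
qed

lemma open_cut_domain: "open cut_domain"
  by (simp add: cut_domain_eq_slit open_slit)

lemma cut_domainD:
  assumes "z \<in> cut_domain"
  shows "1 - z \<notin> \<real>\<^sub>\<le>\<^sub>0" "1 + z \<notin> \<real>\<^sub>\<le>\<^sub>0" "1 - z \<noteq> 0" "1 + z \<noteq> 0"
  using assms by (auto simp: cut_domain_eq_slit slit_def complex_nonpos_Reals_iff complex_eq_iff)

lemma Ln_one_minus_square:
  assumes "z \<in> cut_domain"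
  shows "Ln (1 - z\<^sup>2) = Ln (1 - z) + Ln (1 + z)"
proof (rule Ln_unique)
  note D = cut_domainD[OF assms]
  show "exp (Ln (1 - z) + Ln (1 + z)) = 1 - z\<^sup>2"
    using D by (simp add: exp_add algebra_simps power2_eq_square)
  consider "Im z > 0" | "Im z < 0" | "Im z = 0" by linarith
  then have "\<bar>Im (Ln (1 - z) + Ln (1 + z))\<bar> < pi"
  proof cases
    case 3
    then have "z = of_real (Re z)" "\<bar>Re z\<bar> < 1"
      using assms by (auto simp: cut_domain_eq_slit slit_def complex_eq_iff)
    then have "1 - z = of_real (1 - Re z)" "1 + z = of_real (1 + Re z)" "1 - Re z > 0" "1 + Re z > 0"
      by (auto simp: complex_eq_iff)
    then have "Im (Ln (1 - z)) = 0" "Im (Ln (1 + z)) = 0"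
      by (simp_all only: Ln_of_real Im_complex_of_real)
    then show ?thesis by simp
  qed (use Im_Ln_neg[of "1 - z"] Im_Ln_neg[of "1 + z"] Im_Ln_pos_lt_imp[of "1 - z"] Im_Ln_pos_lt_imp[of "1 + z"] in auto)
  then show "- pi < Im (Ln (1 - z) + Ln (1 + z))" "Im (Ln (1 - z) + Ln (1 + z)) \<le> pi" by auto
qed

text \<open>
  On the real axis all logarithms are real. Elsewhere \<open>1 + z\<close> and \<open>1 - z\<close> lie in opposite half-planes, so
  the quotient is first taken with \<open>z - 1\<close>; the two resulting corrections by \<open>\<i> \<pi>\<close> cancel.
\<close>
lemma Ln_moebius_cut_domain:
  assumes "z \<in> cut_domain"
  shows "Ln ((1 + z) / (1 - z)) = Ln (1 + z) - Ln (1 - z)"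
proof (cases "Im z = 0")
  case True
  then have "z = of_real (Re z)" "\<bar>Re z\<bar> < 1"
    using assms by (auto simp: cut_domain_eq_slit slit_def complex_eq_iff)
  then obtain r where r: "z = of_real r" "\<bar>r\<bar> < 1" by blast
  then have e: "1 - z = of_real (1 - r)" "1 + z = of_real (1 + r)" 
      "(1 + z) / (1 - z) = of_real ((1 + r) / (1 - r))" "1 - r > 0" "1 + r > 0" "(1 + r) / (1 - r) > 0"
    by auto
  have "Ln ((1 + z) / (1 - z)) = of_real (ln ((1 + r) / (1 - r)))"
    unfolding e(3) by (rule Ln_of_real[OF e(6)])
  moreover have "Ln (1 + z) = of_real (ln (1 + r))" unfolding e(2) by (rule Ln_of_real[OF e(5)])
  moreover have "Ln (1 - z) = of_real (ln (1 - r))" unfolding e(1) by (rule Ln_of_real[OF e(4)])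
  ultimately show ?thesis using ln_divide_pos[OF e(5,4)] by simp
next
  case False
  define \<sigma> :: real where "\<sigma> = sgn (Im z)"
  have \<sigma>: "\<sigma> = 1 \<or> \<sigma> = -1" "\<sigma> * Im z > 0" using False by (auto simp: \<sigma>_def sgn_if)
  then have \<sigma>': "- \<sigma> = 1 \<or> - \<sigma> = -1" by auto
  let ?u = "(1 + z) / (z - 1)"
  have "z \<noteq> 1" using False by auto
  then have pos: "(Re (z - 1))\<^sup>2 + (Im (z - 1))\<^sup>2 > 0" by (intro iffD1[OF complex_neq_0]) simp
  have "(-\<sigma>) * Im ?u = 2 * (\<sigma> * Im z) / ((Re (z - 1))\<^sup>2 + (Im (z - 1))\<^sup>2)"
    by (simp add: Im_divide algebra_simps diff_divide_distrib add_divide_distrib)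
  then have "(-\<sigma>) * Im ?u > 0" using \<sigma>(2) pos by (metis divide_pos_pos mult_pos_pos zero_less_numeral)
  from Ln_uminus_halfplane[OF \<sigma>' this] have 1: "Ln (- ?u) = Ln ?u + \<sigma> * (\<i> * pi)" by simp
  have "(-\<sigma>) * Im (1 - z) > 0" using \<sigma> by auto
  from Ln_uminus_halfplane[OF \<sigma>' this] have 2: "Ln (z - 1) = Ln (1 - z) + \<sigma> * (\<i> * pi)" by simp
  have "Ln ?u = Ln (1 + z) - Ln (z - 1)"
    by (rule Ln_divide_halfplane[of \<sigma>]) (use \<sigma> in auto)
  moreover have "- ?u = (1 + z) / (1 - z)" by (metis minus_diff_eq minus_divide_right)
  ultimately show ?thesis using 1 2 by simp
qed

lemma boundary_above_eq:
  assumes g: "g holomorphic_on cut_domain" and fg: "\<And>z. Im z > 0 \<Longrightarrow> f z = g z" and x: "x \<in> {-1<..<1}"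
  shows "boundary_above f x = g (of_real x)"
proof -
  have "of_real x \<in> cut_domain" using x by (simp add: cut_domain_eq_slit of_real_in_slit)
  then have "isCont g (of_real x)"
    using continuous_on_eq_continuous_at[OF open_cut_domain] holomorphic_on_imp_continuous_on[OF g] by blast
  moreover have "((\<lambda>\<epsilon>. Complex x \<epsilon>) \<longlongrightarrow> of_real x) (at_right 0)"
    unfolding complex_of_real_def by (intro tendsto_intros)
  ultimately have "((\<lambda>\<epsilon>. g (Complex x \<epsilon>)) \<longlongrightarrow> g (of_real x)) (at_right 0)"
    by (rule isCont_tendsto_compose)
  moreover have "eventually (\<lambda>\<epsilon>. f (Complex x \<epsilon>) = g (Complex x \<epsilon>)) (at_right (0::real))"
    using eventually_at_right_less[of "0::real"] by eventually_elim (simp add: fg)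
  ultimately have "((\<lambda>\<epsilon>. f (Complex x \<epsilon>)) \<longlongrightarrow> g (of_real x)) (at_right 0)"
    using tendsto_cong by fast
  then show ?thesis unfolding boundary_above_def by (intro tendsto_Lim) auto
qed

lemma boundary_below_eq:
  assumes g: "g holomorphic_on cut_domain" and fg: "\<And>z. Im z < 0 \<Longrightarrow> f z = g z" and x: "x \<in> {-1<..<1}"
  shows "boundary_below f x = g (of_real x)"
proof -
  have "of_real x \<in> cut_domain" using x by (simp add: cut_domain_eq_slit of_real_in_slit)
  then have "isCont g (of_real x)"
    using continuous_on_eq_continuous_at[OF open_cut_domain] holomorphic_on_imp_continuous_on[OF g] by blast
  moreover have "((\<lambda>\<epsilon>. Complex x (- \<epsilon>)) \<longlongrightarrow> Complex x (- 0)) (at_right 0)"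
    by (intro tendsto_intros)
  ultimately have "((\<lambda>\<epsilon>. g (Complex x (- \<epsilon>))) \<longlongrightarrow> g (of_real x)) (at_right 0)"
    using isCont_tendsto_compose[of "of_real x" g] by (simp add: complex_of_real_def)
  moreover have "eventually (\<lambda>\<epsilon>. f (Complex x (- \<epsilon>)) = g (Complex x (- \<epsilon>))) (at_right (0::real))"
    using eventually_at_right_less[of "0::real"] by eventually_elim (simp add: fg)
  ultimately have "((\<lambda>\<epsilon>. f (Complex x (- \<epsilon>))) \<longlongrightarrow> g (of_real x)) (at_right 0)"
    using tendsto_cong by fast
  then show ?thesis unfolding boundary_below_def by (intro tendsto_Lim) auto
qed

lemma continue_from_interval_eq:
  assumes g: "g holomorphic_on cut_domain" and fg: "\<And>x. x \<in> {-1<..<1} \<Longrightarrow> f x = g (of_real x)"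
    and z: "z \<in> cut_domain"
  shows "continue_from_interval f z = g z"
proof -
  let ?A = "complex_of_real ` {-1<..<1}"
  let ?h = "continue_from_interval f"
  have gA: "g w = f (Re w)" if "w \<in> ?A" for w using that fg by auto
  have h: "?h holomorphic_on cut_domain" "\<And>w. w \<in> ?A \<Longrightarrow> ?h w = f (Re w)"
    unfolding continue_from_interval_def by (rule analytic_continuation_spec[OF g gA]; assumption)+
  have "?h z - g z = 0"
  proof (rule analytic_continuation[of "\<lambda>z. ?h z - g z" cut_domain ?A 0])
    show "(\<lambda>z. ?h z - g z) holomorphic_on cut_domain" by (intro holomorphic_intros h g)
    show "open cut_domain" "connected cut_domain" "0 \<in> cut_domain"
      using open_slit connected_slit[of "{-1<..<1}" 0] of_real_in_slit[of 0 "{-1<..<1}"]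
      by (auto simp: cut_domain_eq_slit)
    show "?A \<subseteq> cut_domain" by (auto simp: cut_domain_eq_slit of_real_in_slit)
    show "0 islimpt ?A"
      unfolding islimpt_approachable
    proof (intro allI impI)
      fix e :: real assume "e > 0"
      then show "\<exists>w\<in>?A. w \<noteq> 0 \<and> dist w 0 < e"
        by (intro bexI[of _ "of_real (min (e / 2) (1 / 2))"]) auto
    qed
  qed (use z h gA in auto)
  then show ?thesis by simp
qed

lemma two_div_one_minus_in_slit:
  assumes "z \<in> cut_domain"
  shows "2 / (1 - z) \<in> slit {1<..}"
proof -
  have "2 / (1 - z) \<noteq> of_real r" if "r \<le> 1" for r
  proof
    assume r: "2 / (1 - z) = of_real r"
    have "z \<noteq> 1" using cut_domainD(3)[OF assms] by auto
    with r have "r \<noteq> 0" by auto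
    with r \<open>z \<noteq> 1\<close> have z: "z = of_real (1 - 2 / r)" by (simp add: field_simps)
    have "Re z = 1 - 2 / r" "Im z = 0" unfolding z by (rule Re_complex_of_real Im_complex_of_real)+
    then have "\<bar>1 - 2 / r\<bar> < 1"
      using assms by (auto simp: cut_domain_eq_slit slit_def abs_less_iff)
    moreover have "2 / r \<le> 0 \<or> 2 / r \<ge> 2" using that \<open>r \<noteq> 0\<close> by (cases "r > 0") (auto simp: field_simps)
    ultimately show False by linarith
  qed
  then show ?thesis by (auto simp: slit_eq_Compl)
qed

lemma Im_two_div_one_minus:
  assumes "\<sigma> * Im z > (0::real)"
  shows "\<sigma> * Im (2 / (1 - z)) > 0"
proof -
  have "z \<noteq> 1" using assms by auto
  then have pos: "(Re (1 - z))\<^sup>2 + (Im (1 - z))\<^sup>2 > 0" by (intro iffD1[OF complex_neq_0]) simp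
  have "\<sigma> * Im (2 / (1 - z)) = 2 * (\<sigma> * Im z) / ((Re (1 - z))\<^sup>2 + (Im (1 - z))\<^sup>2)"
    unfolding Im_divide by (simp add: mult_ac)
  then show ?thesis using assms pos by (metis divide_pos_pos mult_pos_pos zero_less_numeral)
qed

text \<open>
  On one half-plane \<open>(z - 1) powr s\<close> is a constant times \<open>(1 - z) powr s\<close>, and the latter is holomorphic on
  the cut domain; the hypergeometric factor extends by \<open>olver_2F1_halfplane_continuation\<close>.
\<close>
lemma jacobi_Q_halfplane_continuation:
  assumes \<sigma>: "\<sigma> = 1 \<or> \<sigma> = -1"
  shows "\<exists>J. J holomorphic_on cut_domain \<and> (\<forall>z. \<sigma> * Im z > 0 \<longrightarrow> jacobi_Q \<gamma> \<alpha> \<beta> z = J z)"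
proof -
  let ?F = "olver_2F1 (\<gamma> + 1) (\<alpha> + \<gamma> + 1) (\<alpha> + \<beta> + 2 * \<gamma> + 2)"
  define T where "T = {z. \<sigma> * Im z > 0}"
  have "T = {z. Im z > 0} \<or> T = {z. Im z < 0}" using \<sigma> by (auto simp: T_def)
  then have T: "open T" "convex T"
    by (auto simp: open_halfspace_Im_gt open_halfspace_Im_lt convex_halfspace_Im_gt convex_halfspace_Im_lt)
  have T0: "Im z \<noteq> 0" if "z \<in> T" for z using that by (auto simp: T_def)
  obtain Y where Y: "Y holomorphic_on slit {1<..}" "\<And>z. z \<in> T \<Longrightarrow> Y z = ?F z"
    using olver_2F1_halfplane_continuation[OF T T0] by blast
  define K where "K = 2 powr (\<alpha> + \<beta> + \<gamma>) * Gamma (\<alpha> + \<gamma> + 1) * Gamma (\<beta> + \<gamma> + 1)"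
  define J where "J z = K / (exp (\<sigma> * (\<i> * pi * (\<alpha> + \<gamma> + 1))) * (1 - z) powr (\<alpha> + \<gamma> + 1) * (1 + z) powr \<beta>)
     * Y (2 / (1 - z))" for z
  have "(Y \<circ> (\<lambda>z. 2 / (1 - z))) holomorphic_on cut_domain"
  proof (rule holomorphic_on_compose_gen[OF _ Y(1)])
    show "(\<lambda>z. 2 / (1 - z)) holomorphic_on cut_domain"
      using cut_domainD by (intro holomorphic_intros) auto
  qed (use two_div_one_minus_in_slit in blast)
  then have "J holomorphic_on cut_domain"
    unfolding J_def o_def using cut_domainD by (intro holomorphic_intros) auto
  moreover have "jacobi_Q \<gamma> \<alpha> \<beta> z = J z" if "\<sigma> * Im z > 0" for z
    using Im_two_div_one_minus[OF that] Y(2)[of "2 / (1 - z)"]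
    by (simp add: jacobi_Q_def J_def K_def T_def powr_minus_one_halfplane[OF \<sigma> that] add.commute[of 1 z])
  ultimately show ?thesis by blast
qed

lemma halfplane_cases:
  assumes "Im z \<noteq> 0"
  obtains \<sigma> :: real where "\<sigma> = 1 \<or> \<sigma> = -1" "\<sigma> * Im z > 0"
  using assms that[of 1] that[of "-1"] by linarith

lemma olver_2F1_quadratic_moebius:
  fixes a b z :: complex
  assumes z: "Im z \<noteq> 0"
  shows "olver_2F1 a b (2 * b) (2 / (1 - z)) = sqrt pi * 2 powr (1 - 2 * b) * rGamma b *
    ((z - 1) / z) powr a * olver_2F1 (a / 2) ((a + 1) / 2) (b + 1 / 2) (1 / z\<^sup>2)"
proof -
  obtain \<sigma> :: real where \<sigma>: "\<sigma> = 1 \<or> \<sigma> = -1" "\<sigma> * Im z > 0" using halfplane_cases[OF z] .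
  have nz: "z \<noteq> 0" "z \<noteq> 1" "1 - z \<noteq> 0" using z by auto
  let ?w = "2 / (1 - z)"
  have w: "?w \<in> slit {..<1}" using Im_two_div_one_minus[OF \<sigma>(2)] by (auto simp: slit_def)
  have 1: "1 - ?w / 2 = z / (z - 1)" using nz by (simp add: divide_simps) (simp add: algebra_simps)
  have "2 - ?w = (-2 * z) / (1 - z)" using nz by (simp add: divide_simps)
  then have "?w / (2 - ?w) = - 1 / z" using nz by (simp add: divide_simps)
  then have 2: "(?w / (2 - ?w))\<^sup>2 = 1 / z\<^sup>2" by (simp add: power_divide)
  have "(z / (z - 1)) powr (- a) = ((z - 1) / z) powr a"
    using \<sigma> nz by (simp add: powr_minus powr_divide_halfplane[of \<sigma> z "z - 1"] powr_divide_halfplane[of \<sigma> "z - 1" z])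
  then show ?thesis unfolding olver_2F1_quadratic[OF w] 1 2 by simp
qed

lemma olver_2F1_commute: "olver_2F1 a b c = olver_2F1 b a c"
proof -
  have "olver_series a b c = olver_series b a c"
    by (rule ext) (simp add: olver_series_def mult.commute[of "pochhammer a _"])
  then show ?thesis by (simp add: olver_2F1_def)
qed

lemma Gamma_rGamma_cancel:
  assumes "a \<notin> neg_naturals"
  shows "Gamma (a + 1) * rGamma (a + 1) = 1"
proof -
  have "a + 1 \<notin> \<int>\<^sub>\<le>\<^sub>0"
  proof
    assume "a + 1 \<in> \<int>\<^sub>\<le>\<^sub>0"
    then obtain n where "a + 1 = - of_nat n" by (auto elim!: nonpos_Ints_cases')
    then have "a = - of_nat n - 1" by (metis add_diff_cancel_right')
    then have "a = - of_nat (Suc n)" by simp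
    then show False using assms unfolding neg_naturals_def by force
  qed
  then show ?thesis by (simp add: rGamma_inverse_Gamma Gamma_eq_zero_iff)
qed

text \<open>
  The quadratic transformation with \<open>a = \<gamma> + 1\<close>, \<open>b = \<alpha> + \<gamma> + 1\<close>; the rest is bookkeeping of principal powers,
  which multiply as expected off the real axis.
\<close>
lemma jacobi_Q_eq_legendre_Q_symmetric:
  assumes ag: "\<alpha> + \<gamma> \<notin> neg_naturals" and g: "\<gamma> \<notin> neg_naturals" and z: "Im z \<noteq> 0"
  shows "jacobi_Q \<gamma> \<alpha> \<alpha> z * ((z - 1) powr (\<alpha> / 2) * (z + 1) powr (\<alpha> / 2))
    = 2 powr \<alpha> * Gamma (\<alpha> + \<gamma> + 1) * rGamma (\<gamma> + 1) * exp (\<i> * pi * \<alpha>) * legendre_Q (\<gamma> + \<alpha>) (- \<alpha>) z"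
proof -
  obtain \<sigma> :: real where \<sigma>: "\<sigma> = 1 \<or> \<sigma> = -1" "\<sigma> * Im z > 0" using halfplane_cases[OF z] .
  have nz: "z \<noteq> 0" "z - 1 \<noteq> 0" "z + 1 \<noteq> 0" using z by (auto simp: complex_eq_iff)
  define b where "b = \<alpha> + \<gamma> + 1"
  define P where "P = (z - 1) powr (\<alpha> / 2)"
  define R where "R = (z + 1) powr (\<alpha> / 2)"
  define Z where "Z = z powr (\<gamma> + 1)"
  define W where "W = (z - 1) powr (\<gamma> + 1)"
  define G where "G = Gamma b"
  define H where "H = olver_2F1 ((\<gamma> + 1) / 2) ((\<gamma> + 2) / 2) (\<gamma> + \<alpha> + 3 / 2) (1 / z\<^sup>2)"
  define p2 where "p2 = (2::complex) powr (- 1 - \<gamma>)"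
  have nzs: "P \<noteq> 0" "R \<noteq> 0" "Z \<noteq> 0" "W \<noteq> 0" "p2 \<noteq> 0"
    using nz by (auto simp: P_def R_def Z_def W_def p2_def)
  have Gr: "G * rGamma b = 1" using Gamma_rGamma_cancel[OF ag] by (simp add: G_def b_def)
  have gr: "Gamma (\<gamma> + 1) * rGamma (\<gamma> + 1) = 1" by (rule Gamma_rGamma_cancel[OF g])
  have e: "exp (\<i> * pi * \<alpha>) * exp (\<i> * pi * (- \<alpha>)) = 1" by (simp flip: exp_add)
  have pows: "(z - 1) powr b = W * (P * P)" "(z + 1) powr \<alpha> = R * R"
    "(z + 1) powr (- \<alpha> / 2) = 1 / R" "(z - 1) powr (- \<alpha> / 2) = 1 / P"
    unfolding W_def P_def R_def b_def
    by (simp_all add: powr_add[symmetric] powr_minus_divide[symmetric] add_ac)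
  have two: "(2::complex) powr (\<alpha> + \<alpha> + \<gamma>) * 2 powr (1 - 2 * b) = p2" "2 powr \<alpha> / (2::complex) powr (\<gamma> + \<alpha> + 1) = p2"
    unfolding p2_def b_def by (simp_all add: powr_add[symmetric] powr_diff[symmetric] algebra_simps)
  have "olver_2F1 (\<gamma> + 1) b (2 * b) (2 / (1 - z)) = sqrt pi * 2 powr (1 - 2 * b) * rGamma b * (W / Z) * H"
    unfolding olver_2F1_quadratic_moebius[OF z]
    using powr_divide_halfplane[of \<sigma> "z - 1" z "\<gamma> + 1"] \<sigma> by (simp add: W_def Z_def H_def b_def add_ac)
  then have "jacobi_Q \<gamma> \<alpha> \<alpha> z = 2 powr (\<alpha> + \<alpha> + \<gamma>) * G * G / (W * (P * P) * (R * R)) *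
      (sqrt pi * 2 powr (1 - 2 * b) * rGamma b * (W / Z) * H)"
    unfolding jacobi_Q_def pows[symmetric] by (simp add: G_def b_def algebra_simps)
  also have "\<dots> = (2 powr (\<alpha> + \<alpha> + \<gamma>) * 2 powr (1 - 2 * b)) * (G * rGamma b) * G * sqrt pi * H / (P * P * R * R * Z)"
    using nzs by (simp add: divide_simps)
  also have "\<dots> = p2 * G * sqrt pi * H / (P * P * R * R * Z)" unfolding two Gr by simp
  finally have J: "jacobi_Q \<gamma> \<alpha> \<alpha> z * (P * R) = p2 * G * sqrt pi * H / (P * R * Z)"
    using nzs by (simp add: divide_simps mult_ac)
  have "legendre_Q (\<gamma> + \<alpha>) (- \<alpha>) z = sqrt pi * exp (\<i> * pi * (- \<alpha>)) * Gamma (\<gamma> + 1) * ((1 / R) * (1 / P)) /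
      (2 powr (\<gamma> + \<alpha> + 1) * Z) * H"
    unfolding legendre_Q_def H_def Z_def pows[symmetric] by (simp add: algebra_simps)
  then have "2 powr \<alpha> * G * rGamma (\<gamma> + 1) * exp (\<i> * pi * \<alpha>) * legendre_Q (\<gamma> + \<alpha>) (- \<alpha>) z =
     (2 powr \<alpha> / 2 powr (\<gamma> + \<alpha> + 1)) * (Gamma (\<gamma> + 1) * rGamma (\<gamma> + 1)) * (exp (\<i> * pi * \<alpha>) * exp (\<i> * pi * (- \<alpha>)))
       * G * sqrt pi * H / (P * R * Z)"
    by (simp add: mult_ac)
  also have "\<dots> = p2 * G * sqrt pi * H / (P * R * Z)" unfolding two gr e by simp
  finally show ?thesis using J by (simp add: P_def R_def G_def b_def)
qed

text \<open>
  The Pfaff transformation replaces \<open>\<alpha> + \<gamma> + 1\<close> by \<open>\<gamma> + 1 - \<alpha>\<close> and \<open>z\<close> by \<open>- z\<close>; then the quadratic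
  transformation applies with \<open>a = \<gamma> + 1 - \<alpha>\<close>, \<open>b = \<gamma> + 1\<close>.
\<close>
lemma jacobi_Q_eq_legendre_Q_antisymmetric:
  assumes z: "Im z \<noteq> 0"
  shows "jacobi_Q \<gamma> \<alpha> (- \<alpha>) z * ((z - 1) powr (\<alpha> / 2) * (z + 1) powr (- \<alpha> / 2))
    = Gamma (\<alpha> + \<gamma> + 1) * rGamma (\<gamma> + 1) * exp (\<i> * pi * \<alpha>) * legendre_Q \<gamma> (- \<alpha>) z"
proof -
  obtain \<sigma> :: real where \<sigma>: "\<sigma> = 1 \<or> \<sigma> = -1" "\<sigma> * Im z > 0" using halfplane_cases[OF z] .
  have nz: "z \<noteq> 0" "z - 1 \<noteq> 0" "z + 1 \<noteq> 0" "1 - z \<noteq> 0" "1 + z \<noteq> 0" using z by (auto simp: complex_eq_iff)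
  define b where "b = \<gamma> + 1"
  define P where "P = (z - 1) powr (\<alpha> / 2)"
  define R where "R = (z + 1) powr (\<alpha> / 2)"
  define Z where "Z = z powr (b - \<alpha>)"
  define W where "W = (z - 1) powr b"
  define V where "V = (z + 1) powr b"
  define H where "H = olver_2F1 ((b - \<alpha>) / 2) ((b - \<alpha> + 1) / 2) (b + 1 / 2) (1 / z\<^sup>2)"
  define p2 where "p2 = (2::complex) powr (- 1 - \<gamma>)"
  define G where "G = Gamma (\<alpha> + \<gamma> + 1) * Gamma (- \<alpha> + \<gamma> + 1)"
  have nzs: "P \<noteq> 0" "R \<noteq> 0" "Z \<noteq> 0" "W \<noteq> 0" "V \<noteq> 0" "p2 \<noteq> 0"
    using nz by (auto simp: P_def R_def Z_def W_def V_def p2_def)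
  have e: "exp (\<i> * pi * \<alpha>) * exp (\<i> * pi * (- \<alpha>)) = 1" by (simp flip: exp_add)
  have pows: "(z - 1) powr (\<alpha> + \<gamma> + 1) = W * (P * P)" "(z + 1) powr (- \<alpha>) = 1 / (R * R)"
    "(z + 1) powr (- \<alpha> / 2) = 1 / R" "(z - 1) powr (- \<alpha> / 2) = 1 / P" "(z + 1) powr (b - \<alpha>) = V / (R * R)"
    unfolding W_def P_def R_def V_def b_def
    by (simp_all add: powr_add[symmetric] powr_diff[symmetric] powr_minus_divide[symmetric] add_ac)
  have two: "(2::complex) powr (\<alpha> + - \<alpha> + \<gamma>) * 2 powr (1 - 2 * b) = p2" "1 / (2::complex) powr (\<gamma> + 1) = p2"
    unfolding p2_def b_def by (simp_all add: powr_add[symmetric] powr_minus_divide[symmetric] algebra_simps)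
  let ?w = "2 / (1 - z)"
  have w: "?w \<in> slit {..<1}" using Im_two_div_one_minus[OF \<sigma>(2)] by (auto simp: slit_def)
  have w1: "1 - ?w = (z + 1) / (z - 1)" using nz by (simp add: divide_simps) (simp add: algebra_simps)
  have "?w - 1 = (1 + z) / (1 - z)" using nz by (simp add: divide_simps)
  then have "?w / (?w - 1) = (2 / (1 - z)) / ((1 + z) / (1 - z))" by simp
  also have "\<dots> = 2 / (1 - (- z))"
  proof -
    have "(2 / u) / (v / u) = 2 / v" if "u \<noteq> 0" for u v :: complex using that by simp
    from this[OF nz(4)] show ?thesis by simp
  qed
  finally have w2: "?w / (?w - 1) = 2 / (1 - (- z))" .
  have "((z + 1) / (z - 1)) powr (- b) = W / V"
    using powr_divide_halfplane[of \<sigma> "z + 1" "z - 1" "b"] \<sigma> by (simp add: powr_minus W_def V_def)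
  moreover have "((- z - 1) / (- z)) powr (b - \<alpha>) = (V / (R * R)) / Z"
  proof -
    have "(- z - 1) / (- z) = (z + 1) / z" using nz by (simp add: divide_simps)
    then show ?thesis using powr_divide_halfplane[of \<sigma> "z + 1" z "b - \<alpha>"] \<sigma> by (simp add: pows Z_def)
  qed
  moreover have "olver_2F1 b (\<alpha> + \<gamma> + 1) (2 * b) ?w
      = (1 - ?w) powr (- b) * olver_2F1 b (2 * b - (\<alpha> + \<gamma> + 1)) (2 * b) (2 / (1 - (- z)))"
    using olver_2F1_pfaff[OF w, of b "\<alpha> + \<gamma> + 1" "2 * b"] unfolding w2 by simp
  moreover have "2 * b - (\<alpha> + \<gamma> + 1) = b - \<alpha>" by (simp add: b_def)
  moreover have "olver_2F1 (b - \<alpha>) b (2 * b) (2 / (1 - (- z))) = sqrt pi * 2 powr (1 - 2 * b) * rGamma b *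
     ((- z - 1) / (- z)) powr (b - \<alpha>) * H"
    using olver_2F1_quadratic_moebius[of "- z" "b - \<alpha>" b] z by (simp add: H_def)
  ultimately have "olver_2F1 b (\<alpha> + \<gamma> + 1) (2 * b) ?w
      = W / V * (sqrt pi * 2 powr (1 - 2 * b) * rGamma b * ((V / (R * R)) / Z) * H)"
    unfolding w1 by (simp only: olver_2F1_commute[of b "b - \<alpha>"])
  then have "jacobi_Q \<gamma> \<alpha> (- \<alpha>) z = 2 powr (\<alpha> + - \<alpha> + \<gamma>) * G / (W * (P * P) * (1 / (R * R))) *
      (W / V * (sqrt pi * 2 powr (1 - 2 * b) * rGamma b * ((V / (R * R)) / Z) * H))"
    unfolding jacobi_Q_def pows(1,2) by (simp add: G_def b_def algebra_simps)
  also have "\<dots> = (2 powr (\<alpha> + - \<alpha> + \<gamma>) * 2 powr (1 - 2 * b)) * G * rGamma b * sqrt pi * H / (P * P * Z)"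
    using nzs by (simp add: divide_simps)
  finally have J: "jacobi_Q \<gamma> \<alpha> (- \<alpha>) z * (P * (1 / R)) = p2 * G * rGamma b * sqrt pi * H / (P * R * Z)"
    unfolding two using nzs by (simp add: divide_simps mult_ac)
  have "legendre_Q \<gamma> (- \<alpha>) z = sqrt pi * exp (\<i> * pi * (- \<alpha>)) * Gamma (- \<alpha> + \<gamma> + 1) * ((1 / R) * (1 / P)) * (1 / 2 powr (\<gamma> + 1)) / Z * H"
    unfolding legendre_Q_def H_def Z_def pows[symmetric] b_def by (simp add: algebra_simps)
  then have "Gamma (\<alpha> + \<gamma> + 1) * rGamma (\<gamma> + 1) * exp (\<i> * pi * \<alpha>) * legendre_Q \<gamma> (- \<alpha>) z =
     (1 / 2 powr (\<gamma> + 1)) * (exp (\<i> * pi * \<alpha>) * exp (\<i> * pi * (- \<alpha>))) * G * rGamma b * sqrt pi * H / (P * R * Z)"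
    by (simp add: G_def b_def mult_ac)
  also have "\<dots> = p2 * G * rGamma b * sqrt pi * H / (P * R * Z)" unfolding two e by simp
  finally show ?thesis using J by (simp only: P_def pows)
qed

text \<open>
  A relation off the real axis passes to the cut: on the upper and the lower half-plane \<open>(z - 1) powr (\<alpha> / 2)\<close>
  contributes the phases \<open>exp (\<plusminus> \<i> \<pi> \<alpha> / 2)\<close>; these turn the weights \<open>exp (\<plusminus> \<i> \<pi> \<alpha>)\<close> of the one-sided limits of
  the Jacobi function into the weights \<open>exp (\<plusminus> \<i> \<pi> \<alpha> / 2)\<close> in the definition of the Ferrers function. If \<open>k = 0\<close>, the Legendre function cannot be recovered from the
  Jacobi function, but then the latter vanishes off the real axis.
\<close>
lemma on_the_cut_transfer:
  assumes rel: "\<And>z. Im z \<noteq> 0 \<Longrightarrow> jacobi_Q \<gamma> \<alpha> \<beta> z * ((z - 1) powr (\<alpha> / 2) * (z + 1) powr t)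
      = k * exp (\<i> * pi * \<alpha>) * legendre_Q \<nu> (- \<alpha>) z"
    and x: "x \<in> cut_domain"
  shows "jacobi_Q_cut \<gamma> \<alpha> \<beta> x * ((1 - x) powr (\<alpha> / 2) * (1 + x) powr t) = k * ferrers_Q \<nu> (- \<alpha>) x"
proof -
  have jac: "jacobi_Q_cut \<gamma> \<alpha> \<beta> x = 1 / 2 * (exp (\<i> * pi * \<alpha>) * Ja x + exp (- \<i> * pi * \<alpha>) * Jb x)"
    if "Ja holomorphic_on cut_domain" "\<And>z. Im z > 0 \<Longrightarrow> jacobi_Q \<gamma> \<alpha> \<beta> z = Ja z"
      "Jb holomorphic_on cut_domain" "\<And>z. Im z < 0 \<Longrightarrow> jacobi_Q \<gamma> \<alpha> \<beta> z = Jb z" for Ja Jb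
    unfolding jacobi_Q_cut_def
    by (rule continue_from_interval_eq[OF _ _ x])
       (use that in \<open>auto intro!: holomorphic_intros simp: boundary_above_eq[OF that(1,2)] boundary_below_eq[OF that(3,4)]\<close>)
  show ?thesis
  proof (cases "k = 0")
    case True
    have "jacobi_Q \<gamma> \<alpha> \<beta> z = 0" if "Im z \<noteq> 0" for z
    proof -
      have "z - 1 \<noteq> 0" "z + 1 \<noteq> 0" using that by (auto simp: complex_eq_iff)
      then show ?thesis using rel[OF that] True by simp
    qed
    then have "jacobi_Q_cut \<gamma> \<alpha> \<beta> x = 0" using jac[of "\<lambda>_. 0" "\<lambda>_. 0"] by simp
    then show ?thesis using True by simp
  next
    case False
    obtain Ja where Ja: "Ja holomorphic_on cut_domain" "\<And>z. Im z > 0 \<Longrightarrow> jacobi_Q \<gamma> \<alpha> \<beta> z = Ja z"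
      using jacobi_Q_halfplane_continuation[of 1 \<gamma> \<alpha> \<beta>] by (simp, blast)
    obtain Jb where Jb: "Jb holomorphic_on cut_domain" "\<And>z. Im z < 0 \<Longrightarrow> jacobi_Q \<gamma> \<alpha> \<beta> z = Jb z"
      using jacobi_Q_halfplane_continuation[of "-1" \<gamma> \<alpha> \<beta>] by (simp, blast)
    define E where "E z = (1 - z) powr (\<alpha> / 2) * (1 + z) powr t" for z
    define c where "c = exp (\<i> * pi * (\<alpha> / 2))"
    have c: "c \<noteq> 0" "exp (\<i> * pi * \<alpha>) = c * c" "exp (- \<i> * pi * \<alpha>) = 1 / (c * c)"
      "exp (- (\<i> * pi * (\<alpha> / 2))) = 1 / c"
      by (simp_all add: c_def exp_add[symmetric] exp_minus inverse_eq_divide[symmetric] mult_ac)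
    have E: "E holomorphic_on cut_domain"
      unfolding E_def using cut_domainD by (intro holomorphic_intros) auto
    define La where "La z = Ja z * E z / (k * c)" for z
    \<comment> \<open>From below \<open>(z - 1) powr (\<alpha> / 2)\<close> carries the phase \<open>1 / c\<close> and not \<open>c\<close>, which gives the two further factors.\<close>
    define Lb where "Lb z = Jb z * E z / (k * c * c * c)" for z
    have La: "legendre_Q \<nu> (- \<alpha>) z = La z" if "Im z > 0" for z
    proof -
      have "(z - 1) powr (\<alpha> / 2) = c * (1 - z) powr (\<alpha> / 2)"
        using powr_minus_one_halfplane[of 1 z "\<alpha> / 2"] that by (simp add: c_def)
      moreover have "Im z \<noteq> 0" using that by simp
      ultimately have "Ja z * (c * E z) = k * (c * c) * legendre_Q \<nu> (- \<alpha>) z"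
        using rel[of z] unfolding Ja(2)[OF that] c(2) E_def by (simp add: add.commute[of 1 z] mult_ac)
      then show ?thesis using False c(1) by (simp add: La_def field_simps)
    qed
    have Lb: "legendre_Q \<nu> (- \<alpha>) z = Lb z" if "Im z < 0" for z
    proof -
      have "(z - 1) powr (\<alpha> / 2) = 1 / c * (1 - z) powr (\<alpha> / 2)"
        using powr_minus_one_halfplane[of "-1" z "\<alpha> / 2"] that by (simp add: c(4)[symmetric])
      moreover have "Im z \<noteq> 0" using that by simp
      ultimately have "Jb z * (1 / c * E z) = k * (c * c) * legendre_Q \<nu> (- \<alpha>) z"
        using rel[of z] unfolding Jb(2)[OF that] c(2) E_def by (simp add: add.commute[of 1 z] mult_ac)
      then show ?thesis using False c(1) by (simp add: Lb_def field_simps)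
    qed
    have hol: "La holomorphic_on cut_domain" "Lb holomorphic_on cut_domain"
      unfolding La_def Lb_def using False c(1) by (auto intro!: holomorphic_intros Ja Jb E)
    have "ferrers_Q \<nu> (- \<alpha>) x = exp (- \<i> * pi * (- \<alpha>)) / 2 *
        (exp (- (1 / 2) * \<i> * pi * (- \<alpha>)) * La x + exp (1 / 2 * \<i> * pi * (- \<alpha>)) * Lb x)"
      unfolding ferrers_Q_def
      by (rule continue_from_interval_eq[OF _ _ x])
         (use hol in \<open>auto intro!: holomorphic_intros simp: boundary_above_eq[OF hol(1) La] boundary_below_eq[OF hol(2) Lb]\<close>)
    also have "\<dots> = c * c / 2 * (c * La x + 1 / c * Lb x)"
      unfolding c(2,4)[symmetric] by (simp add: c_def)
    finally have F: "ferrers_Q \<nu> (- \<alpha>) x = c * c / 2 * (c * La x + 1 / c * Lb x)" .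
    have fer: "k * ferrers_Q \<nu> (- \<alpha>) x = 1 / 2 * (c * c * Ja x + 1 / (c * c) * Jb x) * E x"
      unfolding F La_def Lb_def using False c(1) by (simp add: field_simps)
    have "jacobi_Q_cut \<gamma> \<alpha> \<beta> x = 1 / 2 * (c * c * Ja x + 1 / (c * c) * Jb x)"
      using jac[OF Ja Jb] unfolding c(2,3) .
    then show ?thesis unfolding fer by (simp add: E_def)
  qed
qed

lemma jacobi_Q_cut_antisymmetric:
  assumes x: "x \<in> cut_domain"
  shows "jacobi_Q_cut \<gamma> \<alpha> (- \<alpha>) x =
    Gamma (\<alpha> + \<gamma> + 1) * rGamma (\<gamma> + 1) * ((1 + x) / (1 - x)) powr (\<alpha> / 2) * ferrers_Q \<gamma> (- \<alpha>) x"
proof -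
  note D = cut_domainD[OF x]
  define A where "A = (1 - x) powr (\<alpha> / 2)"
  define B where "B = (1 + x) powr (\<alpha> / 2)"
  have AB: "A \<noteq> 0" "B \<noteq> 0" using D by (auto simp: A_def B_def)
  have M: "((1 + x) / (1 - x)) powr (\<alpha> / 2) = B / A"
    using D by (simp add: A_def B_def powr_def Ln_moebius_cut_domain[OF x] exp_diff[symmetric] diff_divide_distrib right_diff_distrib)
  have N: "(1 + x) powr (- \<alpha> / 2) = 1 / B"
    by (simp add: B_def powr_minus_divide)
  have "jacobi_Q_cut \<gamma> \<alpha> (- \<alpha>) x * (A * (1 / B)) = Gamma (\<alpha> + \<gamma> + 1) * rGamma (\<gamma> + 1) * ferrers_Q \<gamma> (- \<alpha>) x"
    unfolding N[symmetric] A_def by (rule on_the_cut_transfer[OF jacobi_Q_eq_legendre_Q_antisymmetric x])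
  then show ?thesis unfolding M using AB by (simp add: field_simps)
qed

theorem theorem2p26:
  fixes x \<alpha> \<gamma> :: complex
  assumes "x \<in> cut_domain"
    and "\<alpha> + \<gamma> \<notin> neg_naturals"
  shows "(\<gamma> \<notin> neg_naturals \<longrightarrow>
            jacobi_Q_cut \<gamma> \<alpha> \<alpha> x =
              2 powr \<alpha> * Gamma (\<alpha> + \<gamma> + 1) * rGamma (\<gamma> + 1) / (1 - x\<^sup>2) powr (\<alpha> / 2)
                * ferrers_Q (\<gamma> + \<alpha>) (- \<alpha>) x) \<and>
         (\<gamma> - \<alpha> \<notin> neg_naturals \<longrightarrow>
            jacobi_Q_cut \<gamma> \<alpha> (- \<alpha>) x =
              Gamma (\<alpha> + \<gamma> + 1) * rGamma (\<gamma> + 1) * ((1 + x) / (1 - x)) powr (\<alpha> / 2)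
                * ferrers_Q \<gamma> (- \<alpha>) x \<and>
            jacobi_Q_cut \<gamma> (- \<alpha>) \<alpha> x =
              Gamma (\<gamma> - \<alpha> + 1) * rGamma (\<gamma> + 1) * ((1 - x) / (1 + x)) powr (\<alpha> / 2)
                * ferrers_Q \<gamma> \<alpha> x)"
proof (intro conjI impI)
  note x = assms(1)
  note D = cut_domainD[OF x]
  show "jacobi_Q_cut \<gamma> \<alpha> \<alpha> x = 2 powr \<alpha> * Gamma (\<alpha> + \<gamma> + 1) * rGamma (\<gamma> + 1) / (1 - x\<^sup>2) powr (\<alpha> / 2)
                * ferrers_Q (\<gamma> + \<alpha>) (- \<alpha>) x" if "\<gamma> \<notin> neg_naturals"
  proof -
    have "1 - x\<^sup>2 = (1 - x) * (1 + x)" by (simp add: power2_eq_square algebra_simps)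
    then have "1 - x\<^sup>2 \<noteq> 0" using D by simp
    then have "(1 - x\<^sup>2) powr (\<alpha> / 2) = (1 - x) powr (\<alpha> / 2) * (1 + x) powr (\<alpha> / 2)"
      using D Ln_one_minus_square[OF x] by (simp add: powr_def exp_add[symmetric] add_divide_distrib algebra_simps)
    moreover have "(1 - x) powr (\<alpha> / 2) \<noteq> 0" "(1 + x) powr (\<alpha> / 2) \<noteq> 0" using D by auto
    ultimately show ?thesis
      using on_the_cut_transfer[OF jacobi_Q_eq_legendre_Q_symmetric[OF assms(2) that] x]
      by (simp add: field_simps)
  qed
  show "jacobi_Q_cut \<gamma> \<alpha> (- \<alpha>) x = Gamma (\<alpha> + \<gamma> + 1) * rGamma (\<gamma> + 1) * ((1 + x) / (1 - x)) powr (\<alpha> / 2)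
                * ferrers_Q \<gamma> (- \<alpha>) x"
    by (rule jacobi_Q_cut_antisymmetric[OF x])
  have "((1 + x) / (1 - x)) powr (- \<alpha> / 2) = ((1 - x) / (1 + x)) powr (\<alpha> / 2)"
  proof -
    have "- x \<in> cut_domain" using x by (auto simp: cut_domain_eq_slit slit_def)
    from Ln_moebius_cut_domain[OF this] have "Ln ((1 - x) / (1 + x)) = - Ln ((1 + x) / (1 - x))"
      unfolding Ln_moebius_cut_domain[OF x] by simp
    then show ?thesis using D by (simp add: powr_def)
  qed
  then show "jacobi_Q_cut \<gamma> (- \<alpha>) \<alpha> x = Gamma (\<gamma> - \<alpha> + 1) * rGamma (\<gamma> + 1) * ((1 - x) / (1 + x)) powr (\<alpha> / 2)
                * ferrers_Q \<gamma> \<alpha> x"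
    using jacobi_Q_cut_antisymmetric[OF x, of \<gamma> "- \<alpha>"] by (simp add: algebra_simps)
qed

end
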